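(* Let $n\ge2$ and $k\ge1$, let $\mathbf D_n\subset SU_2$ be the binary dihedral group of order $4n$ with generators $g,h$, let $V=\mathbb C^2$, and let $\mathbf C_{2n}$ be the cyclic subgroup generated by $g$. Write $Z_k(\mathbf D_n)=\mathrm{End}_{\mathbf D_n}(V^{\otimes k})$ and $Z_k(\mathbf C_{2n})=\mathrm{End}_{\mathbf C_{2n}}(V^{\otimes k})$. (a) $Z_k(\mathbf D_n)=\{X\in Z_k(\mathbf C_{2n})\mid hX=Xh\}$. (b) A basis for $Z_k(\mathbf D_n)$ is the set $$\mathcal B^k(\mathbf D_n)=\{\mathsf E_{\mathsf r,\mathsf s}+\mathsf E_{-\mathsf r,-\mathsf s}\mid\mathsf r,\mathsf s\in\{-1,1\}^k,\ \mathsf r\succ-\mathsf r,\ |\mathsf r|\equiv|\mathsf s|\bmod n\}.$$ (c) The dimension of $Z_k(\mathbf D_n)$ is $$\dim Z_k(\mathbf D_n)=\tfrac12\dim Z_k(\mathbf C_{2n})=\tfrac12\sum_{\substack{0\le a,b\le k\\ a\equiv b\bmod n}}\binom ka\binom kb=\tfrac12\Big(\text{coefficient of }z^k\text{ in }(1+z)^{2k}\big|_{z^n=1}\Big).$$ (d) The number of walks of $2k$ steps on the affine Dynkin diagram of type $\hat{\mathsf D}_{n+2}$ starting and ending at node $0$ is $\displaystyle\tfrac12\sum_{\substack{0\le a,b\le k\\ a\equiv b\bmod n}}\binom ka\binom kb$.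
   Context: $\mathbf D_n$ is generated by $g=\mathrm{diag}(\zeta^{-1},\zeta)$, $\zeta$ a primitive $2n$th root of unity, and $h=\begin{pmatrix}0&i\\i&0\end{pmatrix}$, $i=\sqrt{-1}$. $V=\mathbb C^2$ has basis $v_{-1}=(1,0)^t$, $v_1=(0,1)^t$; the groups act diagonally on $V^{\otimes k}$ (so $h$ in (a) denotes its action on $V^{\otimes k}$). For $\mathsf r\in\{-1,1\}^k$: $v_{\mathsf r}=v_{r_1}\otimes\cdots\otimes v_{r_k}$, $-\mathsf r=(-r_1,\dots,-r_k)$, $|\mathsf r|$ is the number of $j$ with $r_j=-1$; $\mathsf E_{\mathsf r,\mathsf s}$ is the matrix unit $\mathsf E_{\mathsf r,\mathsf s}v_{\mathsf t}=\delta_{\mathsf s,\mathsf t}v_{\mathsf r}$. Order on $\{-1,1\}^k$: $\mathsf r\succeq\mathsf s$ if $|\mathsf r|<|\mathsf s|$, or $|\mathsf r|=|\mathsf s|$ and $\mathsf r$ is greater than or equal to $\mathsf s$ in the lexicographic order coming from $1>-1$; $\mathsf r\succ\mathsf s$ means $\mathsf r\succeq\mathsf s$ and $\mathsf r\ne\mathsf s$. $(1+z)^{2k}|_{z^n=1}$ means the image in $\mathbb C[z]/(z^n-1)$, exponents read modulo $n$. The affine Dynkin diagram $\hat{\mathsf D}_{n+2}$ has nodes $0,0',1,2,\dots,n-1,n,n'$, with the path $1-2-\cdots-(n-1)$, nodes $0,0'$ joined to $1$, and nodes $n,n'$ joined to $n-1$ (for $n=2$: the four nodes $0,0',2,2'$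 joined to $1$). *)

theory Defs
  imports
    "HOL-Analysis.Analysis"
    "HOL-Algebra.Generated_Groups"
    "HOL-Computational_Algebra.Polynomial"
    "HOL-Library.Function_Algebras"
    "HOL-Number_Theory.Cong"
begin
definition is_primitive_root_of_unity :: "nat \<Rightarrow> complex \<Rightarrow> bool" where
  "is_primitive_root_of_unity m \<zeta> \<longleftrightarrow> 0 < m \<and> \<zeta> ^ m = 1 \<and> (\<forall>j. 0 < j \<and> j < m \<longrightarrow> \<zeta> ^ j \<noteq> 1)"

definition SU2 :: "(complex^2^2) monoid" where
  "SU2 = \<lparr>carrier = {A. A ** (\<chi> i j. cnj (A $ j $ i)) = mat 1 \<and> det A = 1},
          mult = (**), one = mat 1\<rparr>"

definition gen_g :: "complex \<Rightarrow> complex^2^2" where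
  "gen_g \<zeta> = vector [vector [inverse \<zeta>, 0], vector [0, \<zeta>]]"

definition gen_h :: "complex^2^2" where
  "gen_h = vector [vector [0, \<i>], vector [\<i>, 0]]"

definition cyclic_group :: "complex \<Rightarrow> (complex^2^2) set" where
  "cyclic_group \<zeta> = generate SU2 {gen_g \<zeta>}"

definition binary_dihedral_group :: "complex \<Rightarrow> (complex^2^2) set" where
  "binary_dihedral_group \<zeta> = generate SU2 {gen_g \<zeta>, gen_h}"

lemma SU2_inverse_right:
  fixes A :: "complex^2^2"
  assumes "A ** (\<chi> i j. cnj (A $ j $ i)) = mat 1"
  shows "(\<chi> i j. cnj (A $ j $ i)) ** A = mat 1"
  using assms by (simp add: matrix_left_right_inverse)

lemma group_SU2: "group SU2"
proof (rule groupI)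
  fix A B assume "A \<in> carrier SU2" "B \<in> carrier SU2"
  then have A: "A ** (\<chi> i j. cnj (A $ j $ i)) = mat 1" "det A = 1"
    and B: "B ** (\<chi> i j. cnj (B $ j $ i)) = mat 1" "det B = 1"
    by (auto simp: SU2_def)
  have "(\<chi> i j. cnj ((A ** B) $ j $ i)) = (\<chi> i j. cnj (B $ j $ i)) ** (\<chi> i j. cnj (A $ j $ i))"
    by (simp add: vec_eq_iff matrix_matrix_mult_def mult.commute)
  then have "(A ** B) ** (\<chi> i j. cnj ((A ** B) $ j $ i))
      = A ** (B ** (\<chi> i j. cnj (B $ j $ i))) ** (\<chi> i j. cnj (A $ j $ i))"
    by (simp add: matrix_mul_assoc)
  then show "A \<otimes>\<^bsub>SU2\<^esub> B \<in> carrier SU2"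
    using A B by (simp add: SU2_def det_mul)
next
  show "\<one>\<^bsub>SU2\<^esub> \<in> carrier SU2"
    by (simp add: SU2_def vec_eq_iff matrix_matrix_mult_def mat_def det_2 forall_2 sum_2)
next
  fix A assume "A \<in> carrier SU2"
  then have A: "A ** (\<chi> i j. cnj (A $ j $ i)) = mat 1" "det A = 1"
    by (auto simp: SU2_def)
  let ?B = "(\<chi> i j. cnj (A $ j $ i)) :: complex^2^2"
  have "(\<chi> i j. cnj (?B $ j $ i)) = A"
    by (simp add: vec_eq_iff)
  moreover have "det ?B = 1"
  proof -
    have "det ?B = cnj (det A)" by (simp add: det_2 mult.commute)
    then show ?thesis using A(2) by simp
  qed
  ultimately have "?B \<in> carrier SU2"
    using SU2_inverse_right[OF A(1)] by (simp add: SU2_def)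
  then show "\<exists>B\<in>carrier SU2. B \<otimes>\<^bsub>SU2\<^esub> A = \<one>\<^bsub>SU2\<^esub>"
    using SU2_inverse_right[OF A(1)] by (intro bexI[of _ ?B]) (auto simp: SU2_def)
qed (auto simp: SU2_def matrix_mul_assoc)

lemma gen_h_in_SU2: "gen_h \<in> carrier SU2"
  by (simp add: SU2_def gen_h_def vec_eq_iff matrix_matrix_mult_def mat_def det_2 forall_2 sum_2)

lemma gen_g_in_SU2:
  assumes "is_primitive_root_of_unity m \<zeta>"
  shows "gen_g \<zeta> \<in> carrier SU2"
proof -
  have "norm \<zeta> ^ m = 1 ^ m" "m > 0"
    using assms by (auto simp: is_primitive_root_of_unity_def simp flip: norm_power)
  then have "norm \<zeta> = 1"
    by (metis norm_ge_zero power_eq_imp_eq_base zero_le_one)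
  then have "\<zeta> * cnj \<zeta> = 1" "\<zeta> \<noteq> 0"
    by (auto simp: complex_norm_square[symmetric])
  then have "inverse \<zeta> * inverse (cnj \<zeta>) = 1"
    by (metis inverse_1 inverse_mult_distrib)
  then show ?thesis using \<open>\<zeta> * cnj \<zeta> = 1\<close> \<open>\<zeta> \<noteq> 0\<close>
    by (simp add: SU2_def gen_g_def vec_eq_iff matrix_matrix_mult_def mat_def det_2 forall_2 sum_2)
qed

definition sign_seqs :: "nat \<Rightarrow> int list set" where
  "sign_seqs k = {r. length r = k \<and> set r \<subseteq> {-1, 1}}"

definition neg_seq :: "int list \<Rightarrow> int list" where
  "neg_seq r = map uminus r"

definition num_neg :: "int list \<Rightarrow> nat" where
  "num_neg r = count_list r (-1)"

definition seq_succeq :: "int list \<Rightarrow> int list \<Rightarrow> bool" where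
  "seq_succeq r s \<longleftrightarrow> num_neg r < num_neg s \<or> (num_neg r = num_neg s \<and> lexordp_eq s r)"

definition seq_succ :: "int list \<Rightarrow> int list \<Rightarrow> bool" where
  "seq_succ r s \<longleftrightarrow> seq_succeq r s \<and> r \<noteq> s"

text \<open>
  The space \<open>V\<^sup>\<otimes>\<^sup>k\<close> is modelled by coordinates with respect to the basis of the \<open>v\<^sub>r\<close>: an element is
  a function on multi-indices that vanishes outside \<^term>\<open>sign_seqs k\<close>.  Addition and zero are the
  pointwise ones.
\<close>

definition tensor_space :: "nat \<Rightarrow> (int list \<Rightarrow> complex) set" where
  "tensor_space k = {x. \<forall>r. r \<notin> sign_seqs k \<longrightarrow> x r = 0}"

definition tensor_scale :: "complex \<Rightarrow> (int list \<Rightarrow> complex) \<Rightarrow> (int list \<Rightarrow> complex)" where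
  "tensor_scale c x = (\<lambda>r. c * x r)"

definition v_idx :: "int \<Rightarrow> 2" where
  "v_idx e = (if e = -1 then 1 else 2)"

definition v_basis :: "int \<Rightarrow> complex^2" where
  "v_basis e = (if e = -1 then vector [1, 0] else vector [0, 1])"

text \<open>The coordinates of \<open>u\<^sub>1 \<otimes> \<dots> \<otimes> u\<^sub>k\<close>; component \<open>v_idx e\<close> of a vector is its coefficient at \<open>v\<^sub>e\<close>.\<close>

definition simple_tensor :: "(complex^2) list \<Rightarrow> (int list \<Rightarrow> complex)" where
  "simple_tensor us =
     (\<lambda>r. if r \<in> sign_seqs (length us) then \<Prod>j<length us. us ! j $ v_idx (r ! j) else 0)"

definition tensor_basis :: "int list \<Rightarrow> (int list \<Rightarrow> complex)" where
  "tensor_basis r = simple_tensor (map v_basis r)"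

text \<open>
  Operators on \<open>V\<^sup>\<otimes>\<^sup>k\<close> are made unique as functions by requiring the value 0 outside
  \<^term>\<open>tensor_space k\<close>, so that operators add and scale pointwise.
\<close>

definition tensor_End :: "nat \<Rightarrow> ((int list \<Rightarrow> complex) \<Rightarrow> (int list \<Rightarrow> complex)) set" where
  "tensor_End k = {X.
     (\<forall>x\<in>tensor_space k. X x \<in> tensor_space k) \<and>
     (\<forall>x\<in>tensor_space k. \<forall>y\<in>tensor_space k. X (x + y) = X x + X y) \<and>
     (\<forall>c. \<forall>x\<in>tensor_space k. X (tensor_scale c x) = tensor_scale c (X x)) \<and>
     (\<forall>x. x \<notin> tensor_space k \<longrightarrow> X x = 0)}"

definition op_scale ::
  "complex \<Rightarrow> ((int list \<Rightarrow> complex) \<Rightarrow> (int list \<Rightarrow> complex)) \<Rightarrow> ((int list \<Rightarrow> complex) \<Rightarrow> (int list \<Rightarrow> complex))"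
  where "op_scale c X = (\<lambda>x. tensor_scale c (X x))"

global_interpretation op: vector_space op_scale
  by unfold_locales
    (auto simp: op_scale_def tensor_scale_def fun_eq_iff algebra_simps)

text \<open>
  The diagonal action: \<open>A\<close> maps \<open>v\<^sub>s\<close> to \<open>A v\<^sub>s\<^sub>1 \<otimes> \<dots> \<otimes> A v\<^sub>s\<^sub>k\<close>, extended linearly.
\<close>

definition tensor_act :: "nat \<Rightarrow> complex^2^2 \<Rightarrow> (int list \<Rightarrow> complex) \<Rightarrow> (int list \<Rightarrow> complex)" where
  "tensor_act k A = (\<lambda>x. if x \<in> tensor_space k
     then \<Sum>s\<in>sign_seqs k. tensor_scale (x s) (simple_tensor (map (\<lambda>e. A *v v_basis e) s))
     else 0)"

text \<open>The matrix unit \<open>E\<^sub>r\<^sub>,\<^sub>s\<close>; here \<open>x s\<close> is the coefficient of \<open>v\<^sub>s\<close> in \<open>x\<close>.\<close>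

definition matrix_unit :: "nat \<Rightarrow> int list \<Rightarrow> int list \<Rightarrow> (int list \<Rightarrow> complex) \<Rightarrow> (int list \<Rightarrow> complex)" where
  "matrix_unit k r s = (\<lambda>x. if x \<in> tensor_space k then tensor_scale (x s) (tensor_basis r) else 0)"

definition centralizer :: "nat \<Rightarrow> (complex^2^2) set \<Rightarrow> ((int list \<Rightarrow> complex) \<Rightarrow> (int list \<Rightarrow> complex)) set" where
  "centralizer k G = {X \<in> tensor_End k. \<forall>A\<in>G. tensor_act k A \<circ> X = X \<circ> tensor_act k A}"

definition dihedral_basis :: "nat \<Rightarrow> nat \<Rightarrow> ((int list \<Rightarrow> complex) \<Rightarrow> (int list \<Rightarrow> complex)) set" where
  "dihedral_basis n k =
     {matrix_unit k r s + matrix_unit k (neg_seq r) (neg_seq s) | r s.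
        r \<in> sign_seqs k \<and> s \<in> sign_seqs k \<and> seq_succ r (neg_seq r) \<and>
        [num_neg r = num_neg s] (mod n)}"

lemma finite_sign_seqs: "finite (sign_seqs k)"
  unfolding sign_seqs_def
  using finite_lists_length_eq[of "{-1, 1 :: int}" k] by (simp add: conj_commute)

lemma tensor_basis_apply:
  assumes "s \<in> sign_seqs k"
  shows "tensor_basis s r = (if r = s then 1 else 0)"
proof (cases "r \<in> sign_seqs k")
  case False
  then show ?thesis using assms
    by (auto simp: tensor_basis_def simple_tensor_def sign_seqs_def)
next
  case True
  have sgn: "t ! j = -1 \<or> t ! j = 1" if "j < k" "t \<in> sign_seqs k" for j t
  proof -
    have "t ! j \<in> set t" using that by (simp add: sign_seqs_def)
    moreover have "set t \<subseteq> {-1, 1}" using that by (simp add: sign_seqs_def)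
    ultimately show ?thesis by blast
  qed
  have len: "length s = k" "length r = k"
    using assms True by (auto simp: sign_seqs_def)
  have entry: "v_basis (s ! j) $ v_idx (r ! j) = (if r ! j = s ! j then 1 else 0)" if "j < k" for j
    using sgn[OF that assms] sgn[OF that True] by (auto simp: v_basis_def v_idx_def)
  have "tensor_basis s r = (\<Prod>j<k. if r ! j = s ! j then 1 else 0)"
    using True len entry by (auto simp: tensor_basis_def simple_tensor_def intro!: prod.cong)
  also have "\<dots> = (if r = s then 1 else 0)"
    using len by (auto simp: list_eq_iff_nth_eq)
  finally show ?thesis .
qed

lemma tensor_basis_in_space: "s \<in> sign_seqs k \<Longrightarrow> tensor_basis s \<in> tensor_space k"
  by (auto simp: tensor_space_def tensor_basis_apply)

lemma matrix_unit_basis: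
  assumes "r \<in> sign_seqs k" "s \<in> sign_seqs k" "t \<in> sign_seqs k"
  shows "matrix_unit k r s (tensor_basis t) = (if s = t then tensor_basis r else 0)"
  using assms by (auto simp: matrix_unit_def tensor_basis_in_space tensor_basis_apply tensor_scale_def fun_eq_iff)

lemma sign_seqs_Suc: "sign_seqs (Suc k) = (\<lambda>(e, s). e # s) ` ({-1, 1} \<times> sign_seqs k)"
proof (intro equalityI subsetI)
  fix r assume "r \<in> sign_seqs (Suc k)"
  then obtain e s where "r = e # s" "e \<in> {-1, 1}" "s \<in> sign_seqs k"
    by (cases r) (auto simp: sign_seqs_def)
  then show "r \<in> (\<lambda>(e, s). e # s) ` ({-1, 1} \<times> sign_seqs k)"
    by (intro image_eqI[of _ _ "(e, s)"]) auto
qed (auto simp: sign_seqs_def)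

lemma sum_prod_sign_seqs:
  fixes f :: "nat \<Rightarrow> int \<Rightarrow> complex"
  shows "(\<Sum>s\<in>sign_seqs k. \<Prod>j<k. f j (s ! j)) = (\<Prod>j<k. \<Sum>e\<in>{-1, 1}. f j e)"
proof (induction k arbitrary: f)
  case 0
  have "sign_seqs 0 = {[]}" by (auto simp: sign_seqs_def)
  then show ?case by simp
next
  case (Suc k)
  have inj: "inj_on (\<lambda>(e, s). e # s) ({-1, 1 :: int} \<times> sign_seqs k)"
    by (auto simp: inj_on_def)
  have "(\<Sum>s\<in>sign_seqs (Suc k). \<Prod>j<Suc k. f j (s ! j))
      = (\<Sum>(e, s)\<in>{-1, 1} \<times> sign_seqs k. f 0 e * (\<Prod>j<k. f (Suc j) (s ! j)))"
    unfolding sign_seqs_Suc sum.reindex[OF inj]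
    by (intro sum.cong) (auto simp: prod.lessThan_Suc_shift simp del: prod.lessThan_Suc)
  also have "\<dots> = (\<Sum>e\<in>{-1, 1}. f 0 e) * (\<Sum>s\<in>sign_seqs k. \<Prod>j<k. f (Suc j) (s ! j))"
    by (simp only: sum_product sum.cartesian_product)
  also have "\<dots> = (\<Prod>j<Suc k. \<Sum>e\<in>{-1, 1}. f j e)"
    by (simp only: Suc.IH[of "\<lambda>j. f (Suc j)"] prod.lessThan_Suc_shift)
  finally show ?case .
qed

lemma sum_fun_apply: "(\<Sum>s\<in>S. F s) r = (\<Sum>s\<in>S. F s r)"
  by (induction S rule: infinite_finite_induct) auto

lemma tensor_act_simple_tensor:
  assumes "length us = k"
  shows "tensor_act k A (simple_tensor us) = simple_tensor (map ((*v) A) us)"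
proof
  fix r
  have mem: "simple_tensor us \<in> tensor_space k"
    using assms by (auto simp: simple_tensor_def tensor_space_def)
  have coord: "(\<Sum>e\<in>{-1, 1}. u $ v_idx e * (A *v v_basis e) $ i) = (A *v u) $ i" for u i
    by (simp add: v_idx_def v_basis_def matrix_vector_mult_def sum_2 mult.commute)
  show "tensor_act k A (simple_tensor us) r = simple_tensor (map ((*v) A) us) r"
  proof (cases "r \<in> sign_seqs k")
    case False
    then show ?thesis using assms mem
      by (auto simp: tensor_act_def simple_tensor_def sum_fun_apply tensor_scale_def sign_seqs_def intro!: sum.neutral)
  next
    case True
    have "tensor_act k A (simple_tensor us) r = (\<Sum>s\<in>sign_seqs k.
        (\<Prod>j<k. us ! j $ v_idx (s ! j)) * (\<Prod>j<k. (A *v v_basis (s ! j)) $ v_idx (r ! j)))"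
      using mem assms True
      by (auto simp: tensor_act_def sum_fun_apply tensor_scale_def simple_tensor_def sign_seqs_def intro!: sum.cong)
    also have "\<dots> = (\<Sum>s\<in>sign_seqs k. \<Prod>j<k. us ! j $ v_idx (s ! j) * (A *v v_basis (s ! j)) $ v_idx (r ! j))"
      by (simp add: prod.distrib)
    also have "\<dots> = (\<Prod>j<k. (A *v (us ! j)) $ v_idx (r ! j))"
      by (simp only: sum_prod_sign_seqs[where k = k and f = "\<lambda>j e. us ! j $ v_idx e * (A *v v_basis e) $ v_idx (r ! j)"] coord)
    also have "\<dots> = simple_tensor (map ((*v) A) us) r"
      using assms True by (simp add: simple_tensor_def)
    finally show ?thesis .
  qed
qed

datatype dynkin_node = Node nat | Node' nat

definition dynkin_D_nodes :: "nat \<Rightarrow> dynkin_node set" where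
  "dynkin_D_nodes n = Node ` {0..n} \<union> {Node' 0, Node' n}"

definition dynkin_D_edges :: "nat \<Rightarrow> dynkin_node set set" where
  "dynkin_D_edges n =
     {{Node i, Node (i + 1)} | i. 1 \<le> i \<and> i + 1 \<le> n - 1} \<union>
     {{Node 0, Node 1}, {Node' 0, Node 1}, {Node n, Node (n - 1)}, {Node' n, Node (n - 1)}}"

text \<open>
  The diagram is simple, so a walk of \<open>m\<close> steps is its sequence of \<open>m + 1\<close> visited nodes.
\<close>

definition dynkin_D_walks :: "nat \<Rightarrow> nat \<Rightarrow> dynkin_node \<Rightarrow> dynkin_node \<Rightarrow> dynkin_node list set" where
  "dynkin_D_walks n m x y =
     {w. length w = m + 1 \<and> set w \<subseteq> dynkin_D_nodes n \<and> hd w = x \<and> last w = y \<and>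
         successively (\<lambda>u v. {u, v} \<in> dynkin_D_edges n) w}"

definition binom_sum :: "nat \<Rightarrow> nat \<Rightarrow> nat" where
  "binom_sum n k =
     (\<Sum>(a, b)\<in>{(a, b). a \<le> k \<and> b \<le> k \<and> [a = b] (mod n)}. (k choose a) * (k choose b))"

text \<open>
  The residue class of \<open>p\<close> in \<open>\<complex>[z]/(z\<^sup>n - 1)\<close> is represented by the remainder of degree less
  than \<open>n\<close>, and the coefficient of \<open>z\<^sup>k\<close> is read off at the exponent \<open>k mod n\<close>.
\<close>

definition coeff_mod_cyclic :: "nat \<Rightarrow> complex poly \<Rightarrow> nat \<Rightarrow> complex" where
  "coeff_mod_cyclic n p k = coeff (p mod (monom 1 n - 1)) (k mod n)"

end

theory Submission
  imports Defs
begin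

text \<open>
  An endomorphism of the tensor power commutes with a group as soon as it commutes with generators
  (lemma \<open>centralizer_generate\<close>); this gives (a) and reduces everything else to conditions on matrix
  entries. The generator \<open>g\<close> acts on \<open>v\<^sub>r\<close> by \<open>\<zeta>\<close> to the power \<open>k - 2|r|\<close>, and \<open>\<zeta>\<close> has order \<open>2n\<close>, so
  commuting with \<open>g\<close> means that the entry at \<open>(r, s)\<close> vanishes unless \<open>|r| \<equiv> |s|\<close> modulo \<open>n\<close>
  (\<open>commute_gen_g_iff\<close>). The generator \<open>h\<close> sends \<open>v\<^sub>r\<close> to \<open>i\<^sup>k v\<^sub>-\<^sub>r\<close>, so commuting with \<open>h\<close> means that the entries
  at \<open>(r, s)\<close> and \<open>(-r, -s)\<close> agree (\<open>commute_gen_h_iff\<close>).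

  Hence the matrix units at congruent pairs form a basis for the cyclic group, and the sums over the
  orbits \<open>{(r, s), (-r, -s)}\<close> of congruent pairs form a basis for the dihedral group. Each orbit has two
  elements because \<open>k \<ge> 1\<close>, and the condition \<open>r \<succ> -r\<close> selects one of them. This is (b), and it shows that
  one dimension is half of the other (\<open>dihedral_basis_properties\<close>, \<open>card_cong_pairs_half\<close>). Sorting the
  congruent pairs by their numbers of negative signs yields the binomial sum in (c), which by
  Vandermonde's identity is the sum of \<open>2k choose j\<close> over \<open>j \<equiv> k\<close> modulo \<open>n\<close>
  (\<open>binom_sum_eq_diagonal\<close>), the coefficient of \<open>z\<^sup>k\<close> in the reduced polynomial.

  The same sum counts closed walks of \<open>2k\<close> steps on a cycle of length \<open>2n\<close>. Folding the cycle by a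
  reflection gives a path from \<open>0\<close> to \<open>n\<close>, and the Dynkin diagram arises from this path by splitting each
  end into two nodes. Each of these nodes is reached by half of the walks that reach the
  corresponding point of the cycle (\<open>dynkin_walks_fold\<close>), which gives the factor 1/2 in (d).
\<close>

section \<open>Operators and their matrix entries\<close>

definition entry :: "((int list \<Rightarrow> complex) \<Rightarrow> (int list \<Rightarrow> complex)) \<Rightarrow> int list \<Rightarrow> int list \<Rightarrow> complex" where
  "entry X r s = X (tensor_basis s) r"

lemma tensor_space_zero: "0 \<in> tensor_space k"
  by (simp add: tensor_space_def)

lemma tensor_space_add: "x \<in> tensor_space k \<Longrightarrow> y \<in> tensor_space k \<Longrightarrow> x + y \<in> tensor_space k"
  by (simp add: tensor_space_def)

lemma tensor_space_scale: "x \<in> tensor_space k \<Longrightarrow> tensor_scale c x \<in> tensor_space k"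
  by (simp add: tensor_space_def tensor_scale_def)

lemma tensor_space_sum: "(\<And>i. i \<in> I \<Longrightarrow> f i \<in> tensor_space k) \<Longrightarrow> (\<Sum>i\<in>I. f i) \<in> tensor_space k"
  by (simp add: tensor_space_def sum_fun_apply)

lemma simple_tensor_in_space: "length us = k \<Longrightarrow> simple_tensor us \<in> tensor_space k"
  by (auto simp: simple_tensor_def tensor_space_def)

lemma tensor_expansion:
  assumes "x \<in> tensor_space k"
  shows "x = (\<Sum>s\<in>sign_seqs k. tensor_scale (x s) (tensor_basis s))"
proof
  fix r
  have "(\<Sum>s\<in>sign_seqs k. tensor_scale (x s) (tensor_basis s)) r
      = (\<Sum>s\<in>sign_seqs k. if s = r then x s else 0)"
    unfolding sum_fun_apply by (intro sum.cong) (auto simp: tensor_scale_def tensor_basis_apply)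
  also have "\<dots> = x r"
    using assms by (auto simp: finite_sign_seqs tensor_space_def)
  finally show "x r = (\<Sum>s\<in>sign_seqs k. tensor_scale (x s) (tensor_basis s)) r" by simp
qed

lemma tensor_End_zero_arg:
  assumes "X \<in> tensor_End k" shows "X 0 = 0"
proof -
  have "X (tensor_scale 0 0) = tensor_scale 0 (X 0)"
    using assms tensor_space_zero by (auto simp: tensor_End_def)
  then show ?thesis by (simp add: tensor_scale_def zero_fun_def)
qed

lemma tensor_End_sum:
  assumes X: "X \<in> tensor_End k" and "\<And>i. i \<in> I \<Longrightarrow> f i \<in> tensor_space k"
  shows "X (\<Sum>i\<in>I. f i) = (\<Sum>i\<in>I. X (f i))"
  using assms(2)
proof (induction I rule: infinite_finite_induct)
  case (insert i I)
  have "X (f i + (\<Sum>i\<in>I. f i)) = X (f i) + X (\<Sum>i\<in>I. f i)"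
    using X insert.prems tensor_space_sum[of I f k] by (auto simp: tensor_End_def)
  also have "X (\<Sum>i\<in>I. f i) = (\<Sum>i\<in>I. X (f i))"
    using insert.prems by (intro insert.IH) auto
  finally show ?case unfolding sum.insert[OF insert.hyps] .
qed (use tensor_End_zero_arg[OF X] in auto)

lemma tensor_End_apply:
  assumes X: "X \<in> tensor_End k" and x: "x \<in> tensor_space k"
  shows "X x = (\<Sum>s\<in>sign_seqs k. tensor_scale (x s) (X (tensor_basis s)))"
proof -
  have "X x = X (\<Sum>s\<in>sign_seqs k. tensor_scale (x s) (tensor_basis s))"
    using tensor_expansion[OF x] by simp
  also have "\<dots> = (\<Sum>s\<in>sign_seqs k. X (tensor_scale (x s) (tensor_basis s)))"
    by (intro tensor_End_sum[OF X] tensor_space_scale tensor_basis_in_space)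
  also have "\<dots> = (\<Sum>s\<in>sign_seqs k. tensor_scale (x s) (X (tensor_basis s)))"
    using X by (intro sum.cong) (auto simp: tensor_End_def tensor_basis_in_space)
  finally show ?thesis .
qed

text \<open>
  By linearity an operator is determined on the tensor space by its values on the \<open>v\<^sub>s\<close>; elsewhere it
  vanishes by convention.
\<close>

lemma tensor_End_eqI_basis:
  assumes X: "X \<in> tensor_End k" and Y: "Y \<in> tensor_End k"
    and "\<And>s. s \<in> sign_seqs k \<Longrightarrow> X (tensor_basis s) = Y (tensor_basis s)"
  shows "X = Y"
proof
  fix x show "X x = Y x"
  proof (cases "x \<in> tensor_space k")
    case True
    then show ?thesis
      using assms(3) by (simp add: tensor_End_apply[OF X] tensor_End_apply[OF Y] cong: sum.cong)
  next
    case False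
    then show ?thesis using X Y by (simp add: tensor_End_def)
  qed
qed

lemma tensor_End_eqI:
  assumes X: "X \<in> tensor_End k" and Y: "Y \<in> tensor_End k"
    and "\<And>r s. r \<in> sign_seqs k \<Longrightarrow> s \<in> sign_seqs k \<Longrightarrow> entry X r s = entry Y r s"
  shows "X = Y"
proof (rule tensor_End_eqI_basis[OF X Y])
  fix s assume s: "s \<in> sign_seqs k"
  have "X (tensor_basis s) \<in> tensor_space k" "Y (tensor_basis s) \<in> tensor_space k"
    using X Y tensor_basis_in_space[OF s] by (auto simp: tensor_End_def)
  then show "X (tensor_basis s) = Y (tensor_basis s)"
    using assms(3)[OF _ s] by (auto simp: tensor_space_def entry_def fun_eq_iff) metis
qed

lemma tensor_End_comp:
  assumes "X \<in> tensor_End k" "Y \<in> tensor_End k"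
  shows "X \<circ> Y \<in> tensor_End k"
  using assms tensor_End_zero_arg[OF assms(1)] by (auto simp: tensor_End_def)

lemma subspace_tensor_End: "op.subspace (tensor_End k)"
  by (rule op.subspaceI)
    (auto simp: tensor_End_def tensor_space_def op_scale_def tensor_scale_def fun_eq_iff algebra_simps)

lemma tensor_act_in_End: "tensor_act k A \<in> tensor_End k"
proof -
  have "(\<Sum>s\<in>sign_seqs k. tensor_scale (x s) (simple_tensor (map (\<lambda>e. A *v v_basis e) s))) \<in> tensor_space k" for x
    by (intro tensor_space_sum tensor_space_scale simple_tensor_in_space) (auto simp: sign_seqs_def)
  then show ?thesis
    by (auto simp: tensor_End_def tensor_act_def tensor_space_add tensor_space_scale)
      (auto simp: fun_eq_iff tensor_scale_def sum_fun_apply algebra_simps sum.distrib sum_distrib_left)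
qed

lemma tensor_act_basis:
  assumes "s \<in> sign_seqs k"
  shows "tensor_act k A (tensor_basis s) = simple_tensor (map (\<lambda>e. A *v v_basis e) s)"
  using assms tensor_act_simple_tensor[of "map v_basis s" k A]
  by (simp add: tensor_basis_def sign_seqs_def o_def)

lemma tensor_act_mult: "tensor_act k (A ** B) = tensor_act k A \<circ> tensor_act k B"
proof (rule tensor_End_eqI_basis[of _ k])
  fix s assume s: "s \<in> sign_seqs k"
  then have "length s = k" by (simp add: sign_seqs_def)
  then show "tensor_act k (A ** B) (tensor_basis s) = (tensor_act k A \<circ> tensor_act k B) (tensor_basis s)"
    by (simp add: tensor_act_basis[OF s] tensor_act_simple_tensor o_def matrix_vector_mul_assoc)
qed (intro tensor_act_in_End tensor_End_comp)+

text \<open>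
  The restriction to the tensor space is essential: outside it the identity matrix acts as zero,
  so it acts as the identity of \<^term>\<open>tensor_End k\<close> and not as the identity function.
\<close>

lemma tensor_act_one:
  assumes "x \<in> tensor_space k"
  shows "tensor_act k (mat 1) x = x"
  using tensor_expansion[OF assms] assms by (simp add: tensor_act_def tensor_basis_def)

lemma matrix_unit_in_End:
  assumes "r \<in> sign_seqs k"
  shows "matrix_unit k r s \<in> tensor_End k"
proof -
  have "tensor_basis r \<in> tensor_space k" using assms by (rule tensor_basis_in_space)
  then show ?thesis
    by (auto simp: tensor_End_def matrix_unit_def tensor_space_add tensor_space_scale)
       (auto simp: fun_eq_iff tensor_scale_def algebra_simps)
qed

lemma entry_matrix_unit:
  assumes "r \<in> sign_seqs k" "s \<in> sign_seqs k" "r' \<in> sign_seqs k" "s' \<in> sign_seqs k"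
  shows "entry (matrix_unit k r s) r' s' = (if r = r' \<and> s = s' then 1 else 0)"
  using assms by (auto simp: entry_def matrix_unit_basis tensor_basis_apply)

lemma entry_add: "entry (X + Y) r s = entry X r s + entry Y r s"
  by (simp add: entry_def)

lemma entry_scale: "entry (op_scale c X) r s = c * entry X r s"
  by (simp add: entry_def op_scale_def tensor_scale_def)

lemma entry_sum: "entry (\<Sum>i\<in>I. F i) r s = (\<Sum>i\<in>I. entry (F i) r s)"
  by (induction I rule: infinite_finite_induct) (auto simp: entry_def)

section \<open>Commutation with a generated group\<close>

lemma commute_inverse:
  assumes X: "X \<in> tensor_End k" and AB: "A ** B = mat 1"  "B ** A = mat 1"
    and comm: "tensor_act k A \<circ> X = X \<circ> tensor_act k A"
  shows "tensor_act k B \<circ> X = X \<circ> tensor_act k B"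
proof (rule tensor_End_eqI_basis[of _ k])
  fix s assume s: "s \<in> sign_seqs k"
  let ?T = "tensor_act k" and ?v = "tensor_basis s"
  have cancel: "?T A (?T B x) = x" "?T B (?T A x) = x" if "x \<in> tensor_space k" for x
    using tensor_act_mult[of k A B] tensor_act_mult[of k B A] tensor_act_one[OF that] AB
    by (auto simp: fun_eq_iff)
  have v: "?v \<in> tensor_space k" by (rule tensor_basis_in_space[OF s])
  then have mem: "X (?T B ?v) \<in> tensor_space k"
    using X tensor_act_in_End[of k B] by (auto simp: tensor_End_def)
  have "?T B (X ?v) = ?T B (X (?T A (?T B ?v)))" by (simp add: cancel v)
  also have "\<dots> = ?T B (?T A (X (?T B ?v)))" by (simp add: comp_eq_dest[OF comm])
  also have "\<dots> = X (?T B ?v)" by (rule cancel(2)[OF mem])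
  finally show "(?T B \<circ> X) ?v = (X \<circ> ?T B) ?v" by simp
qed (intro tensor_act_in_End tensor_End_comp X)+

lemma SU2_inverse:
  assumes "A \<in> carrier SU2"
  shows "A ** (inv\<^bsub>SU2\<^esub> A) = mat 1" "(inv\<^bsub>SU2\<^esub> A) ** A = mat 1"
  using group.r_inv[OF group_SU2 assms] group.l_inv[OF group_SU2 assms] by (simp_all add: SU2_def)

text \<open>
  The matrices whose action commutes with a fixed \<open>X\<close> are closed under products and inverses,
  because the action is multiplicative. Applied to \<open>{g}\<close> and to \<open>{g, h}\<close>, this gives part (a).
\<close>

lemma centralizer_generate:
  assumes S: "S \<subseteq> carrier SU2"
  shows "centralizer k (generate SU2 S) = centralizer k S"
proof
  show "centralizer k (generate SU2 S) \<subseteq> centralizer k S"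
    by (auto simp: centralizer_def intro: generate.incl)
  show "centralizer k S \<subseteq> centralizer k (generate SU2 S)"
  proof
    fix X assume "X \<in> centralizer k S"
    then have X: "X \<in> tensor_End k"
      and comm: "\<And>A. A \<in> S \<Longrightarrow> tensor_act k A \<circ> X = X \<circ> tensor_act k A"
      by (auto simp: centralizer_def)
    have "tensor_act k A \<circ> X = X \<circ> tensor_act k A" if "A \<in> generate SU2 S" for A
      using that
    proof induction
      case one
      have "tensor_act k (mat 1) \<circ> X = X \<circ> tensor_act k (mat 1)"
      proof (rule tensor_End_eqI_basis[of _ k])
        fix s assume "s \<in> sign_seqs k"
        then have "tensor_basis s \<in> tensor_space k" by (rule tensor_basis_in_space)
        moreover from this have "X (tensor_basis s) \<in> tensor_space k" using X by (simp add: tensor_End_def)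
        ultimately show "(tensor_act k (mat 1) \<circ> X) (tensor_basis s) = (X \<circ> tensor_act k (mat 1)) (tensor_basis s)"
          by (simp add: tensor_act_one)
      qed (intro tensor_act_in_End tensor_End_comp X)+
      then show ?case by (simp add: SU2_def)
    next
      case (incl A) then show ?case by (rule comm)
    next
      case (inv A)
      with S have "A \<in> carrier SU2" by auto
      from commute_inverse[OF X SU2_inverse[OF this] comm[OF inv]] show ?case .
    next
      case (eng A B)
      have "tensor_act k (A ** B) \<circ> X = tensor_act k A \<circ> (tensor_act k B \<circ> X)"
        by (simp only: tensor_act_mult comp_assoc)
      also have "\<dots> = (tensor_act k A \<circ> X) \<circ> tensor_act k B"
        by (simp only: eng.IH(2) comp_assoc)
      also have "\<dots> = X \<circ> tensor_act k (A ** B)"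
        by (simp only: eng.IH(1) tensor_act_mult comp_assoc)
      finally have "tensor_act k (A ** B) \<circ> X = X \<circ> tensor_act k (A ** B)" .
      then show ?case by (simp add: SU2_def)
    qed
    with X show "X \<in> centralizer k (generate SU2 S)" by (simp add: centralizer_def)
  qed
qed

lemma subspace_centralizer: "op.subspace (centralizer k G)"
proof (rule op.subspaceI)
  have T: "tensor_act k A (x + y) = tensor_act k A x + tensor_act k A y"
    "tensor_act k A (tensor_scale c x) = tensor_scale c (tensor_act k A x)"
    if "x \<in> tensor_space k" "y \<in> tensor_space k" for A x y c
    using that tensor_act_in_End[of k A] by (auto simp: tensor_End_def)
  have mem: "X x \<in> tensor_space k" if "X \<in> tensor_End k" for X x
    using that by (cases "x \<in> tensor_space k") (auto simp: tensor_End_def tensor_space_zero)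
  show "0 \<in> centralizer k G"
    using op.subspace_0[OF subspace_tensor_End] tensor_End_zero_arg[OF tensor_act_in_End]
    by (auto simp: centralizer_def fun_eq_iff)
  show "X + Y \<in> centralizer k G" if "X \<in> centralizer k G" "Y \<in> centralizer k G" for X Y
    using that op.subspace_add[OF subspace_tensor_End] T(1)[OF mem mem]
    by (auto simp: centralizer_def fun_eq_iff)
  show "op_scale c X \<in> centralizer k G" if "X \<in> centralizer k G" for c X
    using that op.subspace_scale[OF subspace_tensor_End] T(2)[OF mem mem]
    by (auto simp: centralizer_def op_scale_def fun_eq_iff[where f = "_ \<circ> _"])
qed

section \<open>Bases detected by matrix entries\<close>

text \<open>
  The families in question are each indexed by certain pairs \<open>(r, s)\<close>, and the matrix entries at these
  pairs form the dual family. Duality gives independence and injectivity of \<open>b\<close>, hence the count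
  of the basis by its index set, while the expansion of \<open>X\<close> by its own entries gives the span.
\<close>

lemma dual_family_basis:
  fixes b :: "int list \<times> int list \<Rightarrow> (int list \<Rightarrow> complex) \<Rightarrow> (int list \<Rightarrow> complex)"
  assumes fin: "finite I" and C: "op.subspace C"
    and b: "\<And>i. i \<in> I \<Longrightarrow> b i \<in> C"
    and dual: "\<And>r s j. (r, s) \<in> I \<Longrightarrow> j \<in> I \<Longrightarrow> entry (b j) r s = (if j = (r, s) then 1 else 0)"
    and expand: "\<And>X. X \<in> C \<Longrightarrow> X = (\<Sum>(r, s)\<in>I. op_scale (entry X r s) (b (r, s)))"
  shows "op.independent (b ` I)" "op.span (b ` I) = C" "op.dim C = card I"
proof -
  have inj: "inj_on b I"
  proof
    fix i j assume ij: "i \<in> I" "j \<in> I" "b i = b j"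
    obtain r s where i: "i = (r, s)" by (cases i)
    have "entry (b j) r s = 1"
      unfolding ij(3)[symmetric] using dual[of r s i] ij(1) i by simp
    then show "i = j" using dual[of r s j] ij i by (simp split: if_splits)
  qed
  show ind: "op.independent (b ` I)"
  proof
    assume "op.dependent (b ` I)"
    then obtain f X where 0: "(\<Sum>X\<in>b ` I. op_scale (f X) X) = 0"
      and X: "X \<in> b ` I" "f X \<noteq> 0"
      using fin by (subst (asm) op.dependent_finite) auto
    then obtain r s where rs: "(r, s) \<in> I" "X = b (r, s)" by auto
    \<comment> \<open>Taking the entry at \<open>(r, s)\<close> in a linear relation isolates the coefficient of \<open>b (r, s)\<close>.\<close>
    have "0 = entry (\<Sum>j\<in>I. op_scale (f (b j)) (b j)) r s"
      using 0 by (simp add: sum.reindex[OF inj] entry_def)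
    also have "\<dots> = (\<Sum>j\<in>I. if j = (r, s) then f (b j) else 0)"
      unfolding entry_sum entry_scale using dual[OF rs(1)] by (intro sum.cong refl) simp
    also have "\<dots> = f X" by (simp add: rs fin)
    finally show False using X(2) by (metis)
  qed
  show span: "op.span (b ` I) = C"
  proof
    show "op.span (b ` I) \<subseteq> C" using b by (intro op.span_minimal C) auto
    show "C \<subseteq> op.span (b ` I)"
    proof
      fix X assume "X \<in> C"
      from expand[OF this] show "X \<in> op.span (b ` I)"
        by (rule ssubst) (rule op.span_sum, auto intro: op.span_scale op.span_base)
    qed
  qed
  have "op.dim C = card (b ` I)"
    using ind by (subst span[symmetric]) (simp add: op.dim_span op.dim_eq_card_independent)
  then show "op.dim C = card I" by (simp add: card_image[OF inj])
qed

section \<open>Commutation with monomial matrices\<close>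

lemma prod_list_nth: "prod_list xs = (\<Prod>j<length xs. xs ! j)"
  by (induction xs) (auto simp: prod.lessThan_Suc_shift simp del: prod.lessThan_Suc)

text \<open>
  Both generators permute the lines spanned by \<open>v\<^sub>-\<^sub>1\<close> and \<open>v\<^sub>1\<close>: for \<open>g\<close> the permutation \<open>\<sigma>\<close> of the
  signs is the identity, for \<open>h\<close> it is negation. Treating monomial matrices in general covers both.
\<close>

lemma tensor_act_monomial:
  assumes s: "s \<in> sign_seqs k"
    and A: "\<And>e. e \<in> {-1, 1} \<Longrightarrow> A *v v_basis e = c e *s v_basis (\<sigma> e)"
  shows "tensor_act k A (tensor_basis s) = tensor_scale (prod_list (map c s)) (tensor_basis (map \<sigma> s))"
proof
  fix r
  have len: "length s = k" and sgn: "set s \<subseteq> {-1, 1}" using s by (auto simp: sign_seqs_def)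
  have "A *v v_basis (s ! j) = c (s ! j) *s v_basis (\<sigma> (s ! j))" if "j < k" for j
    using sgn len that by (intro A) (metis nth_mem subsetD)
  then show "tensor_act k A (tensor_basis s) r = tensor_scale (prod_list (map c s)) (tensor_basis (map \<sigma> s)) r"
    using len unfolding tensor_act_basis[OF s]
    by (simp add: tensor_basis_def tensor_scale_def simple_tensor_def prod_list_nth prod.distrib[symmetric])
qed

lemma map_sign_seqs:
  assumes "bij_betw \<sigma> {-1, 1} {-1, 1}"
  shows "bij_betw (map \<sigma>) (sign_seqs k) (sign_seqs k)"
proof -
  have bij: "bij_betw (map \<sigma>) (lists {-1, 1}) (lists {-1, 1})" by (rule bij_lists[OF assms])
  have S: "r \<in> sign_seqs k \<longleftrightarrow> r \<in> lists {-1, 1} \<and> length r = k" for r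
    by (auto simp: sign_seqs_def)
  have "map \<sigma> ` sign_seqs k = sign_seqs k"
  proof (intro equalityI subsetI)
    fix r assume "r \<in> map \<sigma> ` sign_seqs k"
    then show "r \<in> sign_seqs k" using bij_betwE[OF bij] unfolding S by (metis S imageE length_map)
  next
    fix r assume r: "r \<in> sign_seqs k"
    then have "r \<in> map \<sigma> ` lists {-1, 1}" using bij_betw_imp_surj_on[OF bij] S by simp
    then obtain t where "t \<in> lists {-1, 1}" "r = map \<sigma> t" by (rule imageE)
    with r show "r \<in> map \<sigma> ` sign_seqs k" by (intro image_eqI[of _ _ t]) (simp_all add: S)
  qed
  then show ?thesis by (intro bij_betw_subset[OF bij]) (auto simp: S)
qed

text \<open>
  The two sides are the entries of \<open>A X\<close> and of \<open>X A\<close> in row \<open>\<sigma> r\<close> and column \<open>s\<close>. Since \<open>\<sigma>\<close> permutes the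
  multi-indices, these rows and columns exhaust all entries.
\<close>

lemma commute_monomial_iff:
  assumes X: "X \<in> tensor_End k" and \<sigma>: "bij_betw \<sigma> {-1, 1} {-1, 1}"
    and A: "\<And>e. e \<in> {-1, 1} \<Longrightarrow> A *v v_basis e = c e *s v_basis (\<sigma> e)"
  shows "tensor_act k A \<circ> X = X \<circ> tensor_act k A \<longleftrightarrow>
    (\<forall>r\<in>sign_seqs k. \<forall>s\<in>sign_seqs k.
       prod_list (map c r) * entry X r s = prod_list (map c s) * entry X (map \<sigma> r) (map \<sigma> s))"
    (is "?L \<longleftrightarrow> ?R")
proof -
  let ?T = "tensor_act k A"
  have bij: "bij_betw (map \<sigma>) (sign_seqs k) (sign_seqs k)" by (rule map_sign_seqs[OF \<sigma>])
  have mem: "map \<sigma> s \<in> sign_seqs k" if "s \<in> sign_seqs k" for s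
    using bij_betwE[OF bij] that by blast
  have left: "entry (?T \<circ> X) (map \<sigma> r) s = prod_list (map c r) * entry X r s"
    if r: "r \<in> sign_seqs k" and s: "s \<in> sign_seqs k" for r s
  proof -
    have "X (tensor_basis s) \<in> tensor_space k"
      using X tensor_basis_in_space[OF s] by (simp add: tensor_End_def)
    then have "entry (?T \<circ> X) (map \<sigma> r) s
        = (\<Sum>t\<in>sign_seqs k. entry X t s * ?T (tensor_basis t) (map \<sigma> r))"
      by (simp add: entry_def tensor_End_apply[OF tensor_act_in_End] sum_fun_apply tensor_scale_def)
    also have "\<dots> = (\<Sum>t\<in>sign_seqs k. if t = r then prod_list (map c r) * entry X r s else 0)"
    proof (rule sum.cong[OF refl])
      fix t assume t: "t \<in> sign_seqs k"
      have "?T (tensor_basis t) = tensor_scale (prod_list (map c t)) (tensor_basis (map \<sigma> t))"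
        by (rule tensor_act_monomial[OF t A])
      moreover have "map \<sigma> r = map \<sigma> t \<longleftrightarrow> t = r"
        using inj_on_eq_iff[OF bij_betw_imp_inj_on[OF bij] r t] by auto
      ultimately show "entry X t s * ?T (tensor_basis t) (map \<sigma> r)
          = (if t = r then prod_list (map c r) * entry X r s else 0)"
        by (simp add: tensor_scale_def tensor_basis_apply[OF mem[OF t]])
    qed
    also have "\<dots> = prod_list (map c r) * entry X r s"
      using r by (simp add: finite_sign_seqs)
    finally show ?thesis .
  qed
  have right: "entry (X \<circ> ?T) r s = prod_list (map c s) * entry X r (map \<sigma> s)"
    if "s \<in> sign_seqs k" for r s
  proof -
    have "?T (tensor_basis s) = tensor_scale (prod_list (map c s)) (tensor_basis (map \<sigma> s))"
      by (rule tensor_act_monomial[OF that A])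
    then show ?thesis
      using X tensor_basis_in_space[OF mem[OF that]]
      by (simp add: entry_def tensor_End_def tensor_scale_def)
  qed
  show ?thesis
  proof
    assume ?L
    then show ?R using left right by metis
  next
    assume R: ?R
    show ?L
    proof (rule tensor_End_eqI[of _ k])
      fix r' s assume r': "r' \<in> sign_seqs k" and s: "s \<in> sign_seqs k"
      obtain r where "r \<in> sign_seqs k" "r' = map \<sigma> r"
        using bij r' unfolding bij_betw_def by blast
      then show "entry (?T \<circ> X) r' s = entry (X \<circ> ?T) r' s"
        using R s by (simp add: left right)
    qed (intro tensor_act_in_End tensor_End_comp X)+
  qed
qed

section \<open>The conditions imposed by the two generators\<close>

lemma primitive_root_power_eq_iff:
  assumes "is_primitive_root_of_unity m \<zeta>"
  shows "\<zeta> ^ a = \<zeta> ^ b \<longleftrightarrow> [a = b] (mod m)"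
proof -
  have m: "0 < m" "\<zeta> ^ m = 1" and prim: "\<And>j. 0 < j \<Longrightarrow> j < m \<Longrightarrow> \<zeta> ^ j \<noteq> 1"
    using assms by (auto simp: is_primitive_root_of_unity_def)
  then have nz: "\<zeta> \<noteq> 0" by (metis power_0_left zero_neq_one less_numeral_extra(3))
  have red: "\<zeta> ^ a = \<zeta> ^ (a mod m)" for a
  proof -
    have "\<zeta> ^ (m * (a div m) + a mod m) = \<zeta> ^ (a mod m)"
      unfolding power_add power_mult m(2) by simp
    then show ?thesis by simp
  qed
  have inj: "i = j" if "i < m" "j < m" "i \<le> j" "\<zeta> ^ i = \<zeta> ^ j" for i j
  proof (rule ccontr)
    assume "i \<noteq> j"
    have "\<zeta> ^ i * \<zeta> ^ (j - i) = \<zeta> ^ i * 1"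
      unfolding power_add[symmetric] using that by simp
    then have "\<zeta> ^ (j - i) = 1" using nz by simp
    then show False using prim[of "j - i"] that \<open>i \<noteq> j\<close> by simp
  qed
  have "\<zeta> ^ a = \<zeta> ^ b \<longleftrightarrow> \<zeta> ^ (a mod m) = \<zeta> ^ (b mod m)" using red by metis
  also have "\<dots> \<longleftrightarrow> a mod m = b mod m"
    using inj m(1) by (metis mod_less_divisor nle_le)
  finally show ?thesis by (simp add: cong_def)
qed

text \<open>
  The eigenvalue of \<open>g\<close> on \<open>v\<^sub>s\<close> is \<open>\<zeta>\<close> to the power \<open>k - 2|s|\<close>, written with a
  denominator since the exponent may be negative.
\<close>

lemma weight_prod:
  fixes \<zeta> :: complex
  assumes "\<zeta> \<noteq> 0"
  shows "prod_list (map (\<lambda>e. if e = -1 then inverse \<zeta> else \<zeta>) s) = \<zeta> ^ length s / \<zeta> ^ (2 * num_neg s)"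
  using assms by (induction s) (auto simp: num_neg_def field_simps)

text \<open>
  An operator commutes with the diagonal \<open>g\<close> iff it preserves the eigenspaces of \<open>g\<close>. As \<open>\<zeta>\<close> has order
  \<open>2n\<close>, the powers with exponents \<open>2|r|\<close> and \<open>2|s|\<close> agree iff \<open>|r|\<close> and \<open>|s|\<close> agree modulo \<open>n\<close>.
\<close>

lemma commute_gen_g_iff:
  assumes \<zeta>: "is_primitive_root_of_unity (2 * n) \<zeta>" and X: "X \<in> tensor_End k"
  shows "tensor_act k (gen_g \<zeta>) \<circ> X = X \<circ> tensor_act k (gen_g \<zeta>) \<longleftrightarrow>
    (\<forall>r\<in>sign_seqs k. \<forall>s\<in>sign_seqs k. entry X r s \<noteq> 0 \<longrightarrow> [num_neg r = num_neg s] (mod n))"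
proof -
  have nz: "\<zeta> \<noteq> 0"
    using \<zeta> by (auto simp: is_primitive_root_of_unity_def power_0_left)
  let ?c = "\<lambda>e :: int. if e = -1 then inverse \<zeta> else \<zeta>"
  have A: "gen_g \<zeta> *v v_basis e = ?c e *s v_basis (id e)" for e :: int
    by (simp add: gen_g_def v_basis_def vec_eq_iff forall_2 matrix_vector_mult_def sum_2)
  have eq: "prod_list (map ?c r) = prod_list (map ?c s) \<longleftrightarrow> [num_neg r = num_neg s] (mod n)"
    if "r \<in> sign_seqs k" "s \<in> sign_seqs k" for r s
  proof -
    have "prod_list (map ?c r) = prod_list (map ?c s) \<longleftrightarrow> \<zeta> ^ (2 * num_neg r) = \<zeta> ^ (2 * num_neg s)"
      using that nz by (auto simp: weight_prod sign_seqs_def field_simps)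
    also have "\<dots> \<longleftrightarrow> [num_neg r = num_neg s] (mod n)"
      unfolding primitive_root_power_eq_iff[OF \<zeta>] by (simp add: cong_def mult_mod_right[symmetric])
    finally show ?thesis .
  qed
  show ?thesis
    unfolding commute_monomial_iff[OF X bij_betw_id A]
    by (intro ball_cong refl) (auto simp: eq[symmetric])
qed

text \<open>
  \<open>h\<close> sends every \<open>v\<^sub>s\<close> to the same multiple \<open>i\<^sup>k\<close> of \<open>v\<^sub>-\<^sub>s\<close>, so the scalars cancel and
  only the symmetry of the entries under negation remains.
\<close>

lemma commute_gen_h_iff:
  assumes X: "X \<in> tensor_End k"
  shows "tensor_act k gen_h \<circ> X = X \<circ> tensor_act k gen_h \<longleftrightarrow>
    (\<forall>r\<in>sign_seqs k. \<forall>s\<in>sign_seqs k. entry X r s = entry X (neg_seq r) (neg_seq s))"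
proof -
  have A: "gen_h *v v_basis e = \<i> *s v_basis (- e)" if "e \<in> {-1, 1}" for e :: int
    using that by (auto simp: gen_h_def v_basis_def vec_eq_iff forall_2 matrix_vector_mult_def sum_2)
  have bij: "bij_betw uminus {-1, 1 :: int} {-1, 1}"
    by (auto simp: bij_betw_def)
  have "prod_list (map (\<lambda>_. \<i>) r) = \<i> ^ length r" for r :: "int list"
    by (induction r) auto
  moreover have "tensor_act k gen_h \<circ> X = X \<circ> tensor_act k gen_h \<longleftrightarrow>
    (\<forall>r\<in>sign_seqs k. \<forall>s\<in>sign_seqs k.
       prod_list (map (\<lambda>_. \<i>) r) * entry X r s = prod_list (map (\<lambda>_. \<i>) s) * entry X (map uminus r) (map uminus s))"
    by (rule commute_monomial_iff[OF X bij A])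
  ultimately show ?thesis
    by (simp add: sign_seqs_def neg_seq_def)
qed

definition cong_pairs :: "nat \<Rightarrow> nat \<Rightarrow> (int list \<times> int list) set" where
  "cong_pairs n k = {(r, s). r \<in> sign_seqs k \<and> s \<in> sign_seqs k \<and> [num_neg r = num_neg s] (mod n)}"

text \<open>
  For \<open>k \<ge> 1\<close>, one representative of each orbit \<open>{(r, s), (-r, -s)}\<close> of congruent pairs.
\<close>

definition half_pairs :: "nat \<Rightarrow> nat \<Rightarrow> (int list \<times> int list) set" where
  "half_pairs n k = {(r, s) \<in> cong_pairs n k. seq_succ r (neg_seq r)}"

lemma finite_cong_pairs: "finite (cong_pairs n k)"
  by (rule finite_subset[of _ "sign_seqs k \<times> sign_seqs k"])
    (auto simp: cong_pairs_def finite_sign_seqs)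

lemma centralizer_cyclic_iff:
  assumes "is_primitive_root_of_unity (2 * n) \<zeta>"
  shows "X \<in> centralizer k (cyclic_group \<zeta>) \<longleftrightarrow> X \<in> tensor_End k \<and>
    (\<forall>r\<in>sign_seqs k. \<forall>s\<in>sign_seqs k. entry X r s \<noteq> 0 \<longrightarrow> (r, s) \<in> cong_pairs n k)"
proof -
  have "X \<in> centralizer k (cyclic_group \<zeta>) \<longleftrightarrow>
      X \<in> tensor_End k \<and> tensor_act k (gen_g \<zeta>) \<circ> X = X \<circ> tensor_act k (gen_g \<zeta>)"
    using centralizer_generate[of "{gen_g \<zeta>}" k] gen_g_in_SU2[OF assms]
    by (auto simp: cyclic_group_def centralizer_def)
  also have "\<dots> \<longleftrightarrow> X \<in> tensor_End k \<and>
      (\<forall>r\<in>sign_seqs k. \<forall>s\<in>sign_seqs k. entry X r s \<noteq> 0 \<longrightarrow> (r, s) \<in> cong_pairs n k)"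
    using commute_gen_g_iff[OF assms, of X k] by (auto simp: cong_pairs_def)
  finally show ?thesis .
qed

lemma centralizer_dihedral_eq:
  assumes "is_primitive_root_of_unity m \<zeta>"
  shows "centralizer k (binary_dihedral_group \<zeta>) =
    {X \<in> centralizer k (cyclic_group \<zeta>). tensor_act k gen_h \<circ> X = X \<circ> tensor_act k gen_h}"
  using centralizer_generate[of "{gen_g \<zeta>}" k] centralizer_generate[of "{gen_g \<zeta>, gen_h}" k]
    gen_g_in_SU2[OF assms] gen_h_in_SU2
  by (auto simp: cyclic_group_def binary_dihedral_group_def centralizer_def)

lemma centralizer_dihedral_iff:
  assumes "is_primitive_root_of_unity (2 * n) \<zeta>"
  shows "X \<in> centralizer k (binary_dihedral_group \<zeta>) \<longleftrightarrow> X \<in> centralizer k (cyclic_group \<zeta>) \<and>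
    (\<forall>r\<in>sign_seqs k. \<forall>s\<in>sign_seqs k. entry X r s = entry X (neg_seq r) (neg_seq s))"
  unfolding centralizer_dihedral_eq[OF assms]
  using commute_gen_h_iff[of X k] by (auto simp: centralizer_def)

lemma neg_seq_neg_seq [simp]: "neg_seq (neg_seq r) = r"
  by (simp add: neg_seq_def o_def)

lemma neg_seq_in_sign_seqs [simp]: "neg_seq r \<in> sign_seqs k \<longleftrightarrow> r \<in> sign_seqs k"
  by (auto simp: neg_seq_def sign_seqs_def)

lemma num_neg_neg_seq:
  assumes "r \<in> sign_seqs k" shows "num_neg (neg_seq r) + num_neg r = k"
proof -
  have "set r \<subseteq> {-1, 1} \<Longrightarrow> num_neg (neg_seq r) + num_neg r = length r"
    by (induction r) (auto simp: num_neg_def neg_seq_def)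
  then show ?thesis using assms by (simp add: sign_seqs_def)
qed

text \<open>
  Negation replaces \<open>|r|\<close> by \<open>k - |r|\<close>, which preserves congruences.
\<close>

lemma neg_seq_in_cong_pairs:
  assumes "(r, s) \<in> cong_pairs n k" shows "(neg_seq r, neg_seq s) \<in> cong_pairs n k"
proof -
  have "num_neg (neg_seq r) + num_neg r = num_neg (neg_seq s) + num_neg s"
    using assms num_neg_neg_seq[of r k] num_neg_neg_seq[of s k] by (simp add: cong_pairs_def)
  moreover have "[num_neg (neg_seq s) + num_neg s = num_neg (neg_seq s) + num_neg r] (mod n)"
    using assms by (simp add: cong_pairs_def cong_add_lcancel_nat cong_sym)
  ultimately have "[num_neg (neg_seq r) = num_neg (neg_seq s)] (mod n)"
    by (metis cong_add_rcancel_nat)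
  then show ?thesis using assms by (simp add: cong_pairs_def)
qed

lemma neg_seq_neq: 
  assumes "r \<in> sign_seqs k" "k \<ge> 1" shows "neg_seq r \<noteq> r"
  using assms by (cases r) (auto simp: sign_seqs_def neg_seq_def)

lemma seq_succ_asym: "seq_succ r s \<Longrightarrow> \<not> seq_succ s r"
  by (auto simp: seq_succ_def seq_succeq_def dest: lexordp_eq_antisym)

lemma seq_succ_total: "r \<noteq> s \<Longrightarrow> seq_succ r s \<or> seq_succ s r"
  using lexordp_eq_linear[of r s] by (auto simp: seq_succ_def seq_succeq_def)

text \<open>
  Since \<open>k \<ge> 1\<close>, no multi-index is its own negative, so totality of the order picks out exactly one of
  \<open>r\<close> and \<open>-r\<close>.
\<close>

lemma half_pairs_neg_iff:
  assumes "(r, s) \<in> cong_pairs n k" "k \<ge> 1"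
  shows "(neg_seq r, neg_seq s) \<in> half_pairs n k \<longleftrightarrow> (r, s) \<notin> half_pairs n k"
proof -
  have "r \<noteq> neg_seq r" using assms neg_seq_neq[of r k] by (auto simp: cong_pairs_def)
  then show ?thesis
    using assms neg_seq_in_cong_pairs[OF assms(1)] seq_succ_total[of r "neg_seq r"]
      seq_succ_asym[of r "neg_seq r"] by (auto simp: half_pairs_def)
qed

section \<open>Dimensions\<close>

lemma card_cong_pairs_half:
  assumes "k \<ge> 1" shows "card (cong_pairs n k) = 2 * card (half_pairs n k)"
proof -
  let ?\<nu> = "\<lambda>(r, s). (neg_seq r, neg_seq s)"
  have fin: "finite (half_pairs n k)"
    by (rule finite_subset[OF _ finite_cong_pairs[of n k]]) (auto simp: half_pairs_def)
  have sub: "p \<in> cong_pairs n k" if "p \<in> half_pairs n k" for p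
    using that by (auto simp: half_pairs_def)
  have inv: "?\<nu> (?\<nu> p) = p" for p by (cases p) simp
  have "cong_pairs n k = half_pairs n k \<union> ?\<nu> ` half_pairs n k"
  proof (intro equalityI subsetI)
    fix p assume p: "p \<in> cong_pairs n k"
    then have "p \<in> half_pairs n k \<or> ?\<nu> p \<in> half_pairs n k"
      using half_pairs_neg_iff[OF _ assms] by (cases p) auto
    then show "p \<in> half_pairs n k \<union> ?\<nu> ` half_pairs n k"
      using image_eqI[of p ?\<nu> "?\<nu> p", OF inv[symmetric]] by blast
  next
    fix p assume "p \<in> half_pairs n k \<union> ?\<nu> ` half_pairs n k"
    then show "p \<in> cong_pairs n k" using sub neg_seq_in_cong_pairs by fastforce
  qed
  moreover have "half_pairs n k \<inter> ?\<nu> ` half_pairs n k = {}"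
    using sub half_pairs_neg_iff[OF _ assms] by fastforce
  moreover have "card (?\<nu> ` half_pairs n k) = card (half_pairs n k)"
    using inv by (intro card_image inj_on_inverseI[of _ ?\<nu>])
  ultimately show ?thesis using fin by (simp add: card_Un_disjoint)
qed

lemma card_num_neg: "card {r \<in> sign_seqs k. num_neg r = a} = k choose a"
proof (induction k arbitrary: a)
  case 0
  have "{r \<in> sign_seqs 0. num_neg r = a} = (if a = 0 then {[]} else {})"
    by (auto simp: sign_seqs_def num_neg_def)
  then show ?case by simp
next
  case (Suc k)
  let ?S = "\<lambda>k a. {r \<in> sign_seqs k. num_neg r = a}"
  have fin: "finite (?S k a)" for a by (simp add: finite_sign_seqs)
  have *: "r \<in> sign_seqs (Suc k) \<longleftrightarrow> (\<exists>s \<in> sign_seqs k. r = (-1) # s \<or> r = 1 # s)" for r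
    unfolding sign_seqs_Suc by auto
  show ?case
  proof (cases a)
    case 0
    have "?S (Suc k) 0 = Cons 1 ` ?S k 0"
      by (auto simp: * num_neg_def split: if_splits)
    then show ?thesis using 0 Suc by (simp add: card_image)
  next
    case (Suc b)
    have "?S (Suc k) (Suc b) = Cons 1 ` ?S k (Suc b) \<union> Cons (-1) ` ?S k b"
      by (auto simp: * num_neg_def split: if_splits)
    also have "card \<dots> = (k choose Suc b) + (k choose b)"
      by (subst card_Un_disjoint) (auto simp: fin card_image Suc.IH)
    finally show ?thesis using Suc by simp
  qed
qed

text \<open>
  Multi-indices with \<open>a\<close> negative entries are the \<open>a\<close>-element subsets of the \<open>k\<close> positions; the
  pairs are sorted by \<open>(a, b) = (|r|, |s|)\<close>.
\<close>

lemma card_cong_pairs: "card (cong_pairs n k) = binom_sum n k"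
proof -
  let ?K = "{(a, b). a \<le> k \<and> b \<le> k \<and> [a = b] (mod n)}"
  let ?w = "\<lambda>(r, s). (num_neg r, num_neg s)"
  have fK: "finite ?K" by (rule finite_subset[of _ "{..k} \<times> {..k}"]) auto
  have le: "num_neg r \<le> k" if "r \<in> sign_seqs k" for r
    using num_neg_neg_seq[OF that] by simp
  have "card (cong_pairs n k) = (\<Sum>ab\<in>?K. \<Sum>p\<in>{p \<in> cong_pairs n k. ?w p = ab}. 1)"
    using le by (subst sum.group[OF finite_cong_pairs fK]) (auto simp: cong_pairs_def)
  also have "\<dots> = (\<Sum>(a, b)\<in>?K. (k choose a) * (k choose b))"
  proof (rule sum.cong[OF refl], clarify)
    fix a b assume "[a = b] (mod n)"
    then have "{p \<in> cong_pairs n k. ?w p = (a, b)}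
        = {r \<in> sign_seqs k. num_neg r = a} \<times> {s \<in> sign_seqs k. num_neg s = b}"
      by (auto simp: cong_pairs_def)
    then show "(\<Sum>p\<in>{p \<in> cong_pairs n k. ?w p = (a, b)}. 1) = (k choose a) * (k choose b)"
      by (simp add: card_cartesian_product card_num_neg)
  qed
  finally show ?thesis by (simp add: binom_sum_def)
qed

lemma dim_centralizer_cyclic:
  assumes "is_primitive_root_of_unity (2 * n) \<zeta>"
  shows "op.dim (centralizer k (cyclic_group \<zeta>)) = card (cong_pairs n k)"
proof (rule dual_family_basis(3)[where b = "\<lambda>(r, s). matrix_unit k r s"])
  note iff = centralizer_cyclic_iff[OF assms, where k = k]
  show "(case i of (r, s) \<Rightarrow> matrix_unit k r s) \<in> centralizer k (cyclic_group \<zeta>)"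
    if "i \<in> cong_pairs n k" for i
    using that unfolding iff
    by (cases i) (auto simp: cong_pairs_def matrix_unit_in_End entry_matrix_unit)
  show "entry (case j of (r, s) \<Rightarrow> matrix_unit k r s) r s = (if j = (r, s) then 1 else 0)"
    if "(r, s) \<in> cong_pairs n k" "j \<in> cong_pairs n k" for r s j
    using that by (cases j) (auto simp: cong_pairs_def entry_matrix_unit)
  show "X = (\<Sum>(r, s)\<in>cong_pairs n k. op_scale (entry X r s) (case (r, s) of (r, s) \<Rightarrow> matrix_unit k r s))"
    (is "X = ?Y") if "X \<in> centralizer k (cyclic_group \<zeta>)" for X
  proof (rule tensor_End_eqI)
    show "X \<in> tensor_End k" using that by (simp add: iff)
    show "?Y \<in> tensor_End k"
      by (intro op.subspace_sum[OF subspace_tensor_End])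
        (auto simp: cong_pairs_def intro!: op.subspace_scale[OF subspace_tensor_End] matrix_unit_in_End)
    fix r' s' assume r': "r' \<in> sign_seqs k" and s': "s' \<in> sign_seqs k"
    have "entry ?Y r' s' = (\<Sum>p\<in>cong_pairs n k. if p = (r', s') then entry X r' s' else 0)"
      unfolding entry_sum using r' s'
      by (intro sum.cong refl) (auto simp: cong_pairs_def entry_scale entry_matrix_unit split: if_splits)
    then show "entry X r' s' = entry ?Y r' s'"
      using that r' s' unfolding iff by (auto simp: finite_cong_pairs)
  qed
qed (simp_all add: finite_cong_pairs subspace_centralizer)

text \<open>
  The two matrix units of a basis element have their nonzero entries on one orbit of negation, of which
  one member is a chosen representative, so the entries at representatives are dual to the basis. An
  operator commuting with \<open>g\<close> and \<open>h\<close> is supported on the congruent pairs and constant on orbits, hence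
  determined by its entries at the representatives.
\<close>

lemma dihedral_basis_properties:
  assumes \<zeta>: "is_primitive_root_of_unity (2 * n) \<zeta>" and k: "k \<ge> 1"
  defines "Z \<equiv> centralizer k (binary_dihedral_group \<zeta>)"
  shows "dihedral_basis n k \<subseteq> Z" "op.independent (dihedral_basis n k)"
    "op.span (dihedral_basis n k) = Z" "op.dim Z = card (half_pairs n k)"
proof -
  define b where "b = (\<lambda>(r, s). matrix_unit k r s + matrix_unit k (neg_seq r) (neg_seq s))"
  have iff: "X \<in> Z \<longleftrightarrow> X \<in> tensor_End k \<and>
      (\<forall>r\<in>sign_seqs k. \<forall>s\<in>sign_seqs k. entry X r s \<noteq> 0 \<longrightarrow> (r, s) \<in> cong_pairs n k) \<and>
      (\<forall>r\<in>sign_seqs k. \<forall>s\<in>sign_seqs k. entry X r s = entry X (neg_seq r) (neg_seq s))" for X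
    by (simp add: Z_def centralizer_dihedral_iff[OF \<zeta>] centralizer_cyclic_iff[OF \<zeta>])
  have basis: "dihedral_basis n k = b ` half_pairs n k"
    by (auto simp: dihedral_basis_def b_def half_pairs_def cong_pairs_def image_iff)
  have fin: "finite (half_pairs n k)"
    by (rule finite_subset[OF _ finite_cong_pairs[of n k]]) (auto simp: half_pairs_def)
  have sub: "(r, s) \<in> cong_pairs n k" if "(r, s) \<in> half_pairs n k" for r s
    using that by (simp add: half_pairs_def)
  have sgn: "r \<in> sign_seqs k" "s \<in> sign_seqs k" if "(r, s) \<in> half_pairs n k" for r s
    using that by (auto simp: half_pairs_def cong_pairs_def)
  have End: "b p \<in> tensor_End k" if "p \<in> half_pairs n k" for p
    using that unfolding b_def
    by (cases p) (auto intro!: op.subspace_add[OF subspace_tensor_End] matrix_unit_in_End dest: sgn)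
  have entry_b: "entry (b p) r' s' =
      (if p = (r', s') then 1 else 0) + (if p = (neg_seq r', neg_seq s') then 1 else 0)"
    if p: "p \<in> half_pairs n k" and r's': "r' \<in> sign_seqs k" "s' \<in> sign_seqs k" for p r' s'
  proof -
    obtain r s where rs: "p = (r, s)" by (cases p)
    then show ?thesis
      using r's' sgn[of r s] p
      by (auto simp: b_def entry_add entry_matrix_unit)
  qed
  have "b p \<in> Z" if p: "p \<in> half_pairs n k" for p
  proof -
    obtain r s where rs: "p = (r, s)" by (cases p)
    have P: "(r, s) \<in> cong_pairs n k" "(neg_seq r, neg_seq s) \<in> cong_pairs n k"
      using p sub neg_seq_in_cong_pairs by (auto simp: rs)
    show ?thesis
      unfolding iff
    proof (intro conjI ballI impI)
      fix r' s' assume r's': "r' \<in> sign_seqs k" "s' \<in> sign_seqs k"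
      show "(r', s') \<in> cong_pairs n k" if "entry (b p) r' s' \<noteq> 0"
        using that P unfolding rs entry_b[OF p r's', unfolded rs] by (auto split: if_splits)
      show "entry (b p) r' s' = entry (b p) (neg_seq r') (neg_seq s')"
        using r's' by (simp add: entry_b[OF p])
    qed (rule End[OF p])
  qed
  moreover have "entry (b p) r s = (if p = (r, s) then 1 else 0)"
    if "(r, s) \<in> half_pairs n k" "p \<in> half_pairs n k" for r s p
    using that half_pairs_neg_iff[OF sub k] by (auto simp: entry_b sgn)
  moreover have "X = (\<Sum>(r, s)\<in>half_pairs n k. op_scale (entry X r s) (b (r, s)))"
    (is "X = ?Y") if "X \<in> Z" for X
  proof (rule tensor_End_eqI)
    show X: "X \<in> tensor_End k" using that by (simp add: iff)
    show "?Y \<in> tensor_End k"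
      by (intro op.subspace_sum[OF subspace_tensor_End])
        (auto intro!: op.subspace_scale[OF subspace_tensor_End] End)
    fix r' s' assume r's': "r' \<in> sign_seqs k" "s' \<in> sign_seqs k"
    have "entry ?Y r' s' = (\<Sum>p\<in>half_pairs n k. (if p = (r', s') then entry X r' s' else 0)
        + (if p = (neg_seq r', neg_seq s') then entry X (neg_seq r') (neg_seq s') else 0))"
      unfolding entry_sum
      by (intro sum.cong refl) (auto simp: entry_scale entry_b r's' split: if_splits)
    also have "\<dots> = (if (r', s') \<in> half_pairs n k then entry X r' s' else 0)
        + (if (neg_seq r', neg_seq s') \<in> half_pairs n k then entry X (neg_seq r') (neg_seq s') else 0)"
      using fin by (simp add: sum.distrib)
    also have "\<dots> = entry X r' s'"
    proof (cases "(r', s') \<in> cong_pairs n k")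
      case True
      have "entry X r' s' = entry X (neg_seq r') (neg_seq s')"
        using that r's' unfolding iff by blast
      then show ?thesis by (simp only: half_pairs_neg_iff[OF True k]) simp
    next
      case False
      then have "(neg_seq r', neg_seq s') \<notin> cong_pairs n k"
        using neg_seq_in_cong_pairs by fastforce
      moreover have "entry X r' s' = 0" using that r's' False unfolding iff by blast
      ultimately show ?thesis using False sub by auto
    qed
    finally show "entry X r' s' = entry ?Y r' s'" by (rule sym)
  qed
  moreover have "op.subspace Z" unfolding Z_def by (rule subspace_centralizer)
  ultimately show "dihedral_basis n k \<subseteq> Z" "op.independent (dihedral_basis n k)"
    "op.span (dihedral_basis n k) = Z" "op.dim Z = card (half_pairs n k)"
    using dual_family_basis[OF fin, of Z b] unfolding basis by blast+
qed

section \<open>Walks on a cycle\<close>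

text \<open>
  The number of walks of \<open>m\<close> steps from \<open>0\<close> to \<open>i\<close> on the cycle of integers modulo \<open>2n\<close>: with \<open>j\<close> steps forward
  and \<open>m - j\<close> backward the displacement is \<open>2j - m\<close>.
\<close>

definition cycle_walks :: "nat \<Rightarrow> nat \<Rightarrow> int \<Rightarrow> nat" where
  "cycle_walks n m i = (\<Sum>j\<le>m. if [2 * int j = int m + i] (mod (2 * int n)) then m choose j else 0)"

lemma cycle_walks_0: "cycle_walks n 0 i = (if [i = 0] (mod (2 * int n)) then 1 else 0)"
  by (simp add: cycle_walks_def cong_sym_eq)

lemma cycle_walks_Suc: "cycle_walks n (Suc m) i = cycle_walks n m (i - 1) + cycle_walks n m (i + 1)"
proof -
  let ?P = "\<lambda>j. [2 * int j = int (Suc m) + i] (mod (2 * int n))"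
  have shift: "?P (Suc j) \<longleftrightarrow> [2 * int j = int m + (i - 1)] (mod (2 * int n))" for j
    using cong_add_rcancel[of "2 * int j" 2 "int m + (i - 1)" "2 * int n"] by (simp add: algebra_simps)
  have "cycle_walks n (Suc m) i
      = (if ?P 0 then 1 else 0) + (\<Sum>j\<le>m. if ?P (Suc j) then Suc m choose Suc j else 0)"
    unfolding cycle_walks_def by (subst sum.atMost_Suc_shift) simp
  also have "(\<Sum>j\<le>m. if ?P (Suc j) then Suc m choose Suc j else 0)
      = (\<Sum>j\<le>m. if ?P (Suc j) then m choose j else 0) + (\<Sum>j\<le>m. if ?P (Suc j) then m choose Suc j else 0)"
    unfolding sum.distrib[symmetric] by (intro sum.cong) auto
  also have "(if ?P 0 then 1 else 0) + ((\<Sum>j\<le>m. if ?P (Suc j) then m choose j else 0)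
        + (\<Sum>j\<le>m. if ?P (Suc j) then m choose Suc j else 0))
      = (\<Sum>j\<le>m. if ?P (Suc j) then m choose j else 0) + (\<Sum>j\<le>Suc m. if ?P j then m choose j else 0)"
    by (subst sum.atMost_Suc_shift) simp
  also have "(\<Sum>j\<le>Suc m. if ?P j then m choose j else 0) = cycle_walks n m (i + 1)"
    by (simp add: cycle_walks_def algebra_simps)
  also have "(\<Sum>j\<le>m. if ?P (Suc j) then m choose j else 0) = cycle_walks n m (i - 1)"
    unfolding shift cycle_walks_def by (rule refl)
  finally show ?thesis .
qed

lemma cycle_walks_uminus: "cycle_walks n m (- i) = cycle_walks n m i"
proof (induction m arbitrary: i)
  case 0
  show ?case using cong_minus_minus_iff[of i 0 "2 * int n"] by (simp add: cycle_walks_0)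
next
  case (Suc m)
  show ?case using Suc[of "i - 1"] Suc[of "i + 1"] by (simp add: cycle_walks_Suc)
qed

lemma cycle_walks_period: "cycle_walks n m (i + 2 * int n) = cycle_walks n m i"
  by (simp add: cycle_walks_def cong_def add.assoc[symmetric])

text \<open>
  Reflection and periodicity give the reflection about \<open>n\<close>, the other end of the folded cycle.
\<close>

lemma cycle_walks_end: "cycle_walks n m (int n + 1) = cycle_walks n m (int n - 1)"
  using cycle_walks_uminus[of n m "int n - 1"] cycle_walks_period[of n m "1 - int n"]
  by (simp add: algebra_simps)

section \<open>Binomial sums and reduction modulo \<open>z\<^sup>n - 1\<close>\<close>

text \<open>
  Replacing \<open>b\<close> by \<open>c = k - b\<close> turns \<open>a \<equiv> b\<close> into \<open>a + c \<equiv> k\<close>. The terms with \<open>a + c = j\<close> then add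
  up to \<open>2k choose j\<close> by Vandermonde's identity.
\<close>

lemma binom_sum_eq_diagonal:
  "binom_sum n k = (\<Sum>j\<le>2 * k. if [j = k] (mod n) then (2 * k) choose j else 0)"
proof -
  let ?K = "{(a, b). a \<le> k \<and> b \<le> k \<and> [a = b] (mod n)}"
  let ?L = "{(a, c). a \<le> k \<and> c \<le> k \<and> [a + c = k] (mod n)}"
  let ?f = "\<lambda>(a, c). (k choose a) * (k choose c)"
  have fL: "finite ?L" by (rule finite_subset[of _ "{..k} \<times> {..k}"]) auto
  have complement: "[a + k - b = k] (mod n) \<longleftrightarrow> [a = b] (mod n)" if "b \<le> k" for a b
    using that cong_add_rcancel_nat[of a "k - b" b n] by simp
  have complement': "[a = k - b] (mod n) \<longleftrightarrow> [a + b = k] (mod n)" if "b \<le> k" for a b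
    using complement[of "k - b" a] that by simp
  have "binom_sum n k = sum ?f ?L"
    unfolding binom_sum_def
    by (rule sum.reindex_bij_witness[of _ "\<lambda>(a, c). (a, k - c)" "\<lambda>(a, b). (a, k - b)"])
      (auto simp: complement complement' binomial_symmetric[symmetric])
  also have "\<dots> = (\<Sum>j\<le>2 * k. \<Sum>p\<in>{p \<in> ?L. fst p + snd p = j}. ?f p)"
    by (rule sum.group[symmetric]) (use fL in auto)
  also have "\<dots> = (\<Sum>j\<le>2 * k. if [j = k] (mod n) then (2 * k) choose j else 0)"
  proof (rule sum.cong[OF refl])
    fix j
    show "(\<Sum>p\<in>{p \<in> ?L. fst p + snd p = j}. ?f p) = (if [j = k] (mod n) then (2 * k) choose j else 0)"
    proof (cases "[j = k] (mod n)")
      case True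
      let ?D = "(\<lambda>a. (a, j - a)) ` {..j}"
      have "(\<Sum>p\<in>{p \<in> ?L. fst p + snd p = j}. ?f p) = sum ?f ?D"
      proof (rule sum.mono_neutral_left)
        show "{p \<in> ?L. fst p + snd p = j} \<subseteq> ?D" by (auto simp: image_iff)
        show "\<forall>p\<in>?D - {p \<in> ?L. fst p + snd p = j}. ?f p = 0"
          using True by (auto simp: binomial_eq_0_iff not_le)
      qed simp
      also have "\<dots> = (\<Sum>a\<le>j. (k choose a) * (k choose (j - a)))"
        by (subst sum.reindex) (auto simp: inj_on_def)
      also have "\<dots> = (2 * k) choose j" by (simp add: vandermonde mult_2)
      finally show ?thesis using True by simp
    next
      case False
      then show ?thesis by (auto intro!: sum.neutral)
    qed
  qed
  finally show ?thesis .
qed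

lemma cycle_walks_closed: "cycle_walks n (2 * k) 0 = binom_sum n k"
proof -
  have "[2 * int j = int (2 * k) + 0] (mod (2 * int n)) \<longleftrightarrow> [j = k] (mod n)" for j
  proof -
    have "[2 * int j = int (2 * k) + 0] (mod (2 * int n)) \<longleftrightarrow> [int j = int k] (mod int n)"
      by (simp add: cong_def mult_mod_right[symmetric])
    then show ?thesis by (simp add: cong_int_iff)
  qed
  then show ?thesis unfolding cycle_walks_def binom_sum_eq_diagonal by simp
qed

text \<open>
  \<open>z\<^sup>n - 1\<close> divides \<open>(z\<^sup>n)\<^sup>q - 1\<close> for every \<open>q\<close>, and a monomial of degree below \<open>n\<close> is its own remainder.
\<close>

lemma monom_mod_cyclic:
  fixes c :: "'a :: field"
  assumes "n > 0"
  shows "monom c j mod (monom 1 n - 1) = monom c (j mod n)"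
proof -
  let ?q = "monom 1 n - 1 :: 'a poly"
  have deg: "degree ?q = n"
    using assms degree_add_eq_left[of "- 1" "monom 1 n :: 'a poly"] by (simp add: degree_monom_eq)
  have pow: "?q dvd monom 1 (n * i) - 1" for i
  proof -
    have "monom 1 n - 1 dvd (monom 1 n) ^ i - (1 :: 'a poly)"
      using power_diff_1_eq[of "monom 1 n :: 'a poly" i] by simp
    then show ?thesis by (simp add: monom_power)
  qed
  have "monom c j - monom c (j mod n) = monom c (j mod n) * (monom 1 (n * (j div n)) - 1)"
    by (simp add: algebra_simps mult_monom)
  then have "?q dvd monom c j - monom c (j mod n)" using pow by simp
  then have "monom c j mod ?q = monom c (j mod n) mod ?q"
    by (metis mod_eq_dvd_iff)
  also have "\<dots> = monom c (j mod n)"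
  proof (cases "c = 0")
    case False
    then show ?thesis using assms by (intro mod_poly_less) (simp add: deg degree_monom_eq)
  qed simp
  finally show ?thesis .
qed

lemma coeff_mod_cyclic_eq:
  assumes "n > 0" "degree p \<le> d"
  shows "coeff_mod_cyclic n p k = (\<Sum>j\<le>d. if [j = k] (mod n) then coeff p j else 0)"
proof -
  let ?q = "monom 1 n - 1 :: complex poly"
  have "p = (\<Sum>j\<le>d. monom (coeff p j) j)"
    by (rule poly_as_sum_of_monoms'[OF assms(2), symmetric])
  then have "p mod ?q = (\<Sum>j\<le>d. monom (coeff p j) j) mod ?q" by simp
  also have "\<dots> = (\<Sum>j\<le>d. monom (coeff p j) j mod ?q)"
    by (induction d) (simp_all add: poly_mod_add_left)
  also have "\<dots> = (\<Sum>j\<le>d. monom (coeff p j) (j mod n))"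
    by (simp add: monom_mod_cyclic[OF assms(1)])
  finally show ?thesis
    by (simp add: coeff_mod_cyclic_def coeff_sum cong_def)
qed

lemma coeff_mod_cyclic_binomial:
  assumes "n > 0"
  shows "coeff_mod_cyclic n ([:1, 1:] ^ (2 * k)) k = of_nat (binom_sum n k)"
proof -
  have deg: "degree ([:1, 1:] ^ (2 * k) :: complex poly) \<le> 2 * k"
    using degree_power_le[of "[:1, 1:] :: complex poly" "2 * k"] by simp
  have "coeff_mod_cyclic n ([:1, 1:] ^ (2 * k)) k
      = (\<Sum>j\<le>2 * k. if [j = k] (mod n) then coeff ([:1, 1:] ^ (2 * k)) j else 0)"
    by (rule coeff_mod_cyclic_eq[OF assms deg])
  also have "\<dots> = (\<Sum>j\<le>2 * k. of_nat (if [j = k] (mod n) then (2 * k) choose j else 0))"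
    by (intro sum.cong) (auto simp: coeff_linear_poly_power)
  finally show ?thesis by (simp add: binom_sum_eq_diagonal)
qed

section \<open>Walks on the affine Dynkin diagram of type D\<close>

definition dynkin_nbrs :: "nat \<Rightarrow> dynkin_node \<Rightarrow> dynkin_node set" where
  "dynkin_nbrs n y = {u \<in> dynkin_D_nodes n. {u, y} \<in> dynkin_D_edges n}"

lemma finite_dynkin_D_walks: "finite (dynkin_D_walks n m x y)"
proof (rule finite_subset)
  show "dynkin_D_walks n m x y \<subseteq> {w. set w \<subseteq> dynkin_D_nodes n \<and> length w = m + 1}"
    by (auto simp: dynkin_D_walks_def)
  show "finite {w. set w \<subseteq> dynkin_D_nodes n \<and> length w = m + 1}"
    by (rule finite_lists_length_eq) (simp add: dynkin_D_nodes_def)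
qed

lemma dynkin_D_walks_0:
  assumes "x \<in> dynkin_D_nodes n"
  shows "dynkin_D_walks n 0 x y = (if y = x then {[x]} else {})"
  using assms by (auto simp: dynkin_D_walks_def length_Suc_conv)

text \<open>
  Deleting the last node of a walk leaves a walk that ends at a neighbour of that node.
\<close>

lemma card_dynkin_D_walks_Suc:
  assumes y: "y \<in> dynkin_D_nodes n"
  shows "card (dynkin_D_walks n (Suc m) x y) = (\<Sum>u\<in>dynkin_nbrs n y. card (dynkin_D_walks n m x u))"
proof -
  have "dynkin_D_walks n (Suc m) x y
      = (\<Union>u\<in>dynkin_nbrs n y. (\<lambda>w. w @ [y]) ` dynkin_D_walks n m x u)" (is "?L = ?R")
  proof (intro equalityI subsetI)
    fix w' assume w': "w' \<in> ?L"
    then obtain w where "w' = w @ [y]"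
      by (cases w' rule: rev_cases) (auto simp: dynkin_D_walks_def)
    with w' have w: "w' = w @ [y]" "w \<noteq> []" by (auto simp: dynkin_D_walks_def)
    then have "last w \<in> set w" by simp
    then have "last w \<in> dynkin_nbrs n y" "w \<in> dynkin_D_walks n m x (last w)"
      using w w' by (auto simp: dynkin_D_walks_def dynkin_nbrs_def successively_append_iff)
    then show "w' \<in> ?R" using w by blast
  next
    fix w' assume "w' \<in> ?R"
    then obtain u w where "u \<in> dynkin_nbrs n y" "w \<in> dynkin_D_walks n m x u" and w': "w' = w @ [y]"
      by auto
    moreover from this have "w \<noteq> []" by (auto simp: dynkin_D_walks_def)
    ultimately show "w' \<in> ?L"
      using y by (auto simp: dynkin_D_walks_def dynkin_nbrs_def successively_append_iff)
  qed
  also have "card ?R = (\<Sum>u\<in>dynkin_nbrs n y. card ((\<lambda>w. w @ [y]) ` dynkin_D_walks n m x u))"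
  proof (rule card_UN_disjoint)
    show "finite (dynkin_nbrs n y)" by (simp add: dynkin_nbrs_def dynkin_D_nodes_def)
  qed (auto simp: finite_dynkin_D_walks, auto simp: dynkin_D_walks_def)
  also have "\<dots> = (\<Sum>u\<in>dynkin_nbrs n y. card (dynkin_D_walks n m x u))"
    by (intro sum.cong refl card_image inj_onI) simp
  finally show ?thesis .
qed

lemma dynkin_nbrs_end:
  assumes "n \<ge> 2"
  shows "dynkin_nbrs n (Node 0) = {Node 1}" "dynkin_nbrs n (Node' 0) = {Node 1}"
    "dynkin_nbrs n (Node n) = {Node (n - 1)}" "dynkin_nbrs n (Node' n) = {Node (n - 1)}"
  using assms by (auto simp: dynkin_nbrs_def dynkin_D_nodes_def dynkin_D_edges_def doubleton_eq_iff)

lemma dynkin_nbrs_inner: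
  assumes "n \<ge> 2" "1 \<le> i" "i \<le> n - 1"
  shows "dynkin_nbrs n (Node i) = (if i = 1 then {Node 0, Node' 0} else {Node (i - 1)})
      \<union> (if i = n - 1 then {Node n, Node' n} else {Node (i + 1)})"
  using assms 
  by (auto simp: dynkin_nbrs_def dynkin_D_nodes_def dynkin_D_edges_def doubleton_eq_iff image_iff)

text \<open>
  The reflection \<open>i \<mapsto> -i\<close> folds the cycle of length \<open>2n\<close> onto the path \<open>0, ..., n\<close>, and the diagram
  splits each end of this path into two nodes. Reflecting makes the step count into an end of the
  path twice that of the cycle neighbour, and the two split nodes each take half of it; conversely
  they contribute together what one cycle node contributes to its inner neighbour. So both counts
  satisfy the same recursion. The halving fails for the walk of no steps, which ends at \<open>0\<close> but not at its
  twin \<open>0'\<close>, so the induction starts with walks of one step.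
\<close>

lemma dynkin_walks_fold:
  assumes n: "n \<ge> 2"
  defines "N \<equiv> \<lambda>m y. card (dynkin_D_walks n m (Node 0) y)"
  shows "(\<forall>i\<in>{1..n - 1}. N (Suc m) (Node i) = cycle_walks n (Suc m) (int i))
    \<and> 2 * N (Suc m) (Node 0) = cycle_walks n (Suc m) 0
    \<and> N (Suc m) (Node' 0) = N (Suc m) (Node 0)
    \<and> 2 * N (Suc m) (Node n) = cycle_walks n (Suc m) (int n)
    \<and> N (Suc m) (Node' n) = N (Suc m) (Node n)"
proof -
  have nodes: "Node i \<in> dynkin_D_nodes n" "Node' 0 \<in> dynkin_D_nodes n" "Node' n \<in> dynkin_D_nodes n"
    if "i \<le> n" for i
    using that by (auto simp: dynkin_D_nodes_def)
  have inner: "N (Suc m) (Node i) = (if i = 1 then N m (Node 0) + N m (Node' 0) else N m (Node (i - 1)))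
      + (if i = n - 1 then N m (Node n) + N m (Node' n) else N m (Node (i + 1)))"
    if i: "i \<in> {1..n - 1}" for i m
  proof -
    have "N (Suc m) (Node i) = (\<Sum>u\<in>(if i = 1 then {Node 0, Node' 0} else {Node (i - 1)})
      \<union> (if i = n - 1 then {Node n, Node' n} else {Node (i + 1)}). N m u)"
    proof -
      have le: "1 \<le> i" "i \<le> n - 1" "i \<le> n" using i by auto
      show ?thesis
        unfolding N_def card_dynkin_D_walks_Suc[OF nodes(1)[OF le(3)]] dynkin_nbrs_inner[OF n le(1,2)] ..
    qed
    then show ?thesis using i n by (subst (asm) sum.union_disjoint) (auto split: if_splits)
  qed
  have ends: "N (Suc m) (Node 0) = N m (Node 1)" "N (Suc m) (Node' 0) = N m (Node 1)"
    "N (Suc m) (Node n) = N m (Node (n - 1))" "N (Suc m) (Node' n) = N m (Node (n - 1))" for m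
    unfolding N_def using n by (simp_all add: card_dynkin_D_walks_Suc nodes dynkin_nbrs_end)
  have c0: "cycle_walks n (Suc m) 0 = 2 * cycle_walks n m 1" for m
    using cycle_walks_uminus[of n m 1] by (simp add: cycle_walks_Suc)
  have cn: "cycle_walks n (Suc m) (int n) = 2 * cycle_walks n m (int n - 1)" for m
    using cycle_walks_end[of n m] by (simp add: cycle_walks_Suc)
  show ?thesis
  proof (induction m)
    case 0
    have N0: "N 0 y = (if y = Node 0 then 1 else 0)" for y
      unfolding N_def using dynkin_D_walks_0[OF nodes(1)[of 0]] by simp
    have C0: "cycle_walks n 0 i = (if i = 0 then 1 else 0)" if "0 \<le> i" "i < 2 * int n" for i
      using that by (simp add: cycle_walks_0 cong_def)
    have "N 1 (Node i) = cycle_walks n 1 (int i)" if "i \<in> {1..n - 1}" for i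
    proof -
      have "cycle_walks n (Suc 0) (int i) = (if i = 1 then 1 else 0)"
        using that C0[of "int i - 1"] C0[of "int i + 1"] by (auto simp: cycle_walks_Suc)
      moreover have "N (Suc 0) (Node i) = (if i = 1 then 1 else 0)"
        using that n by (auto simp: inner[OF that] N0)
      ultimately show ?thesis by simp
    qed
    then show ?case
      using n c0[of 0] cn[of 0] C0[of 1] C0[of "int n - 1"] by (auto simp: ends N0)
  next
    case (Suc m)
    have IH: "N (Suc m) (Node i) = cycle_walks n (Suc m) (int i)" if "i \<in> {1..n - 1}" for i
      using Suc that by blast
    have "N (Suc (Suc m)) (Node i) = cycle_walks n (Suc (Suc m)) (int i)" if i: "i \<in> {1..n - 1}" for i
    proof -
      have "(if i = 1 then N (Suc m) (Node 0) + N (Suc m) (Node' 0) else N (Suc m) (Node (i - 1)))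
          = cycle_walks n (Suc m) (int i - 1)"
      proof (cases "i = 1")
        case False
        then have "i - 1 \<in> {1..n - 1}" "int (i - 1) = int i - 1" using i by auto
        then show ?thesis using False IH[of "i - 1"] by simp
      qed (use Suc in simp)
      moreover have "(if i = n - 1 then N (Suc m) (Node n) + N (Suc m) (Node' n) else N (Suc m) (Node (i + 1)))
          = cycle_walks n (Suc m) (int i + 1)"
      proof (cases "i = n - 1")
        case False
        then have "i + 1 \<in> {1..n - 1}" "int (i + 1) = int i + 1" using i by auto
        then show ?thesis using False IH[of "i + 1"] by (simp add: add.commute)
      next
        case True
        then have "int i + 1 = int n" using n by simp
        then show ?thesis using True Suc by simp
      qed
      ultimately show ?thesis unfolding inner[OF i] cycle_walks_Suc[of n "Suc m"] by simp
    qed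
    moreover have "N (Suc m) (Node 1) = cycle_walks n (Suc m) 1"
      "N (Suc m) (Node (n - 1)) = cycle_walks n (Suc m) (int n - 1)"
      using IH[of 1] IH[of "n - 1"] n by (simp_all add: of_nat_diff)
    ultimately show ?case by (simp add: ends c0 cn)
  qed
qed

section \<open>Centralizer algebra and closed walks\<close>

theorem theorem3p13:
  fixes n k :: nat and \<zeta> :: complex
  assumes "n \<ge> 2" and "k \<ge> 1"
    and "is_primitive_root_of_unity (2 * n) \<zeta>"
  shows
   "(centralizer k (binary_dihedral_group \<zeta>) =
       {X \<in> centralizer k (cyclic_group \<zeta>). tensor_act k gen_h \<circ> X = X \<circ> tensor_act k gen_h})
   \<and>
   (dihedral_basis n k \<subseteq> centralizer k (binary_dihedral_group \<zeta>) \<and>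
     op.independent (dihedral_basis n k) \<and>
     op.span (dihedral_basis n k) = centralizer k (binary_dihedral_group \<zeta>))
   \<and>
   ((of_nat (op.dim (centralizer k (binary_dihedral_group \<zeta>))) :: complex)
       = 1/2 * of_nat (op.dim (centralizer k (cyclic_group \<zeta>))) \<and>
     (1/2 * of_nat (op.dim (centralizer k (cyclic_group \<zeta>))) :: complex)
       = 1/2 * of_nat (binom_sum n k) \<and>
     (1/2 * of_nat (binom_sum n k) :: complex)
       = 1/2 * coeff_mod_cyclic n ([:1, 1:] ^ (2 * k)) k)
   \<and>
   real (card (dynkin_D_walks n (2 * k) (Node 0) (Node 0))) = 1/2 * real (binom_sum n k)"
proof -
  note cyclic = dim_centralizer_cyclic[OF assms(3), of k]
  note dihedral = dihedral_basis_properties[OF assms(3,2)]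
  have "op.dim (centralizer k (cyclic_group \<zeta>)) = 2 * op.dim (centralizer k (binary_dihedral_group \<zeta>))"
    by (simp only: cyclic dihedral(4) card_cong_pairs_half[OF assms(2)])
  then have dims: "(of_nat (op.dim (centralizer k (binary_dihedral_group \<zeta>))) :: complex)
      = 1/2 * of_nat (op.dim (centralizer k (cyclic_group \<zeta>)))"
    by simp
  have "op.dim (centralizer k (cyclic_group \<zeta>)) = binom_sum n k"
    by (simp only: cyclic card_cong_pairs)
  moreover have "coeff_mod_cyclic n ([:1, 1:] ^ (2 * k)) k = of_nat (binom_sum n k)"
    using assms(1) by (intro coeff_mod_cyclic_binomial) simp
  moreover have "2 * card (dynkin_D_walks n (2 * k) (Node 0) (Node 0)) = binom_sum n k"
    using dynkin_walks_fold[OF assms(1), of "2 * k - 1"] assms(2) by (simp add: cycle_walks_closed)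
  then have "real (card (dynkin_D_walks n (2 * k) (Node 0) (Node 0))) = 1/2 * real (binom_sum n k)"
    by linarith
  ultimately show ?thesis
    using centralizer_dihedral_eq[OF assms(3), of k] dihedral(1-3) dims
    by (intro conjI) simp_all
qed

end
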